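(* Let $G$ be a split graph on $n\ge 2$ vertices with $m$ edges. Then for each $k\in\{1,2,\dots,n-1\}$, $$s_k(G)\le m+\binom{k+1}{2},$$ with equality if and only if $G$ is a threshold graph on $n$ vertices with clique number $k+1$.
   Context: All graphs are finite, simple and undirected. For a graph $G$ on $n$ vertices, $L(G)=D(G)-A(G)$ is its Laplacian matrix ($D(G)$ the diagonal matrix of degrees, $A(G)$ the adjacency matrix), with eigenvalues $\mu_1(G)\ge\dots\ge\mu_n(G)$, and $s_k(G)=\sum_{i=1}^k\mu_i(G)$. A split graph is a graph whose vertex set can be partitioned into a clique and an independent set. A threshold graph is a graph that can be built from a single vertex by repeatedly adding either a new isolated vertex or a new dominating vertex (adjacent to all previously present vertices). The clique number is the maximum size of a clique. *)

theory Defs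
  imports
    Jordan_Normal_Form.Char_Poly
    "HOL-Library.Multiset"
begin

text \<open>A graph is given by its vertex set \<open>V\<close> and its edge set \<open>E\<close>, where the edge joining
  \<open>u\<close> and \<open>v\<close> is the set \<open>{u, v}\<close>.\<close>

definition simple_graph :: "'a set \<Rightarrow> 'a set set \<Rightarrow> bool" where
  "simple_graph V E \<longleftrightarrow> finite V \<and> (\<forall>e\<in>E. e \<subseteq> V \<and> card e = 2)"

definition degree_of :: "'a set set \<Rightarrow> 'a \<Rightarrow> nat" where
  "degree_of E v = card {e \<in> E. v \<in> e}"

definition is_clique :: "'a set \<Rightarrow> 'a set set \<Rightarrow> 'a set \<Rightarrow> bool" where
  "is_clique V E K \<longleftrightarrow> K \<subseteq> V \<and> (\<forall>u\<in>K. \<forall>v\<in>K. u \<noteq> v \<longrightarrow> {u, v} \<in> E)"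

definition is_independent :: "'a set \<Rightarrow> 'a set set \<Rightarrow> 'a set \<Rightarrow> bool" where
  "is_independent V E I \<longleftrightarrow> I \<subseteq> V \<and> (\<forall>u\<in>I. \<forall>v\<in>I. {u, v} \<notin> E)"

definition clique_number :: "'a set \<Rightarrow> 'a set set \<Rightarrow> nat" where
  "clique_number V E = Max (card ` {K. is_clique V E K})"

text \<open>Either part of the partition may be empty, so complete graphs and edgeless graphs are split
  graphs.\<close>

definition split_graph :: "'a set \<Rightarrow> 'a set set \<Rightarrow> bool" where
  "split_graph V E \<longleftrightarrow>
     (\<exists>K I. K \<union> I = V \<and> K \<inter> I = {} \<and> is_clique V E K \<and> is_independent V E I)"

inductive threshold_graph :: "'a set \<Rightarrow> 'a set set \<Rightarrow> bool" where
  single: "threshold_graph {v} {}"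
| isolated: "threshold_graph V E \<Longrightarrow> v \<notin> V \<Longrightarrow> threshold_graph (insert v V) E"
| dominating: "threshold_graph V E \<Longrightarrow> v \<notin> V \<Longrightarrow>
    threshold_graph (insert v V) (E \<union> (\<lambda>u. {u, v}) ` V)"

text \<open>The matrices of a graph depend on a numbering of its vertices, given by a list \<open>vs\<close> in which
  every vertex occurs exactly once.\<close>

definition adjacency_matrix :: "'a list \<Rightarrow> 'a set set \<Rightarrow> real mat" where
  "adjacency_matrix vs E =
     mat (length vs) (length vs) (\<lambda>(i, j). if {vs ! i, vs ! j} \<in> E then 1 else 0)"

definition degree_matrix :: "'a list \<Rightarrow> 'a set set \<Rightarrow> real mat" where
  "degree_matrix vs E =
     mat (length vs) (length vs) (\<lambda>(i, j). if i = j then real (degree_of E (vs ! i)) else 0)"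

definition laplacian_matrix :: "'a list \<Rightarrow> 'a set set \<Rightarrow> real mat" where
  "laplacian_matrix vs E = degree_matrix vs E - adjacency_matrix vs E"

text \<open>The real eigenvalues of \<open>A\<close> in nonincreasing order, each repeated according to its
  multiplicity as a root of the characteristic polynomial. For a symmetric matrix of dimension
  \<open>n\<close>, and hence for a Laplacian, this list has length \<open>n\<close>; see
  \<open>length_eigenvalues_symmetric\<close> and \<open>length_laplacian_eigenvalues\<close> below.\<close>

definition eigenvalues_desc :: "real mat \<Rightarrow> real list" where
  "eigenvalues_desc A = rev (sorted_list_of_multiset (proots (char_poly A)))"

text \<open>Eigenvalues are numbered from 1, list positions from 0.\<close>

definition laplacian_eigenvalue :: "'a list \<Rightarrow> 'a set set \<Rightarrow> nat \<Rightarrow> real" where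
  "laplacian_eigenvalue vs E i = eigenvalues_desc (laplacian_matrix vs E) ! (i - 1)"

definition laplacian_sum :: "'a list \<Rightarrow> 'a set set \<Rightarrow> nat \<Rightarrow> real" where
  "laplacian_sum vs E k = (\<Sum>i=1..k. laplacian_eigenvalue vs E i)"

lemma symmetric_eigenvalue_real:
  fixes A :: "real mat"
  assumes A: "A \<in> carrier_mat n n" and sym: "transpose_mat A = A"
    and ev: "eigenvalue (map_mat complex_of_real A) z"
  shows "cnj z = z"
proof -
  let ?C = "map_mat complex_of_real A"
  have C: "?C \<in> carrier_mat n n" using A by simp
  have symC: "transpose_mat ?C = ?C"
    using sym by (metis map_mat_transpose)
  from ev C obtain v where v: "v \<in> carrier_vec n" "v \<noteq> 0\<^sub>v n" "?C *\<^sub>v v = z \<cdot>\<^sub>v v"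
    unfolding eigenvalue_def eigenvector_def by auto
  have cv: "conjugate v \<in> carrier_vec n" using v(1) by simp
  have "?C *\<^sub>v conjugate v = conjugate (?C *\<^sub>v v)"
    using A v(1) by (intro eq_vecI) (auto simp: scalar_prod_def)
  also have "\<dots> = cnj z \<cdot>\<^sub>v conjugate v"
    using v by (auto simp: conjugate_smult_vec)
  finally have 1: "?C *\<^sub>v conjugate v = cnj z \<cdot>\<^sub>v conjugate v" .
  have "z * (v \<bullet>c v) = (transpose_mat ?C *\<^sub>v v) \<bullet> conjugate v"
    using v cv by (simp add: symC)
  also have "\<dots> = v \<bullet> (?C *\<^sub>v conjugate v)"
    by (rule transpose_vec_mult_scalar[OF C cv v(1)])
  also have "\<dots> = cnj z * (v \<bullet>c v)"
    using 1 v cv by simp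
  finally show ?thesis
    using v by (simp add: conjugate_square_eq_0_vec)
qed

lemma length_eigenvalues_symmetric:
  assumes A: "A \<in> carrier_mat n n" and sym: "transpose_mat A = A"
  shows "length (eigenvalues_desc A) = n"
proof -
  let ?C = "map_mat complex_of_real A"
  have C: "?C \<in> carrier_mat n n" using A by simp
  obtain as where as: "char_poly ?C = (\<Prod>a\<leftarrow>as. [:- a, 1:])" "length as = n"
    using char_poly_factorized[OF C] by blast
  have real: "complex_of_real (Re a) = a" if "a \<in> set as" for a
  proof -
    have "poly (char_poly ?C) a = 0"
      using that unfolding as(1) by (auto simp: poly_prod_list o_def prod_list_zero_iff)
    then have "cnj a = a"
      using symmetric_eigenvalue_real[OF A sym] eigenvalue_root_char_poly[OF C] by blast
    then show ?thesis by (metis Reals_cnj_iff of_real_Re)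
  qed
  interpret h: map_poly_inj_comm_ring_hom complex_of_real ..
  have *: "(\<Prod>a\<leftarrow>xs. [:- a, 1:]) = map_poly complex_of_real (\<Prod>a\<leftarrow>map Re xs. [:- a, 1:])"
    if "\<And>a. a \<in> set xs \<Longrightarrow> complex_of_real (Re a) = a" for xs
    using that by (induction xs) (auto simp: h.hom_mult simp del: mult_pCons_left)
  have "map_poly complex_of_real (char_poly A) = char_poly ?C"
    by (rule of_real_hom.char_poly_hom[OF A, symmetric])
  also have "\<dots> = map_poly complex_of_real (\<Prod>a\<leftarrow>map Re as. [:- a, 1:])"
    using as(1) *[OF real] by simp
  finally have "char_poly A = (\<Prod>a\<leftarrow>map Re as. [:- a, 1:])"
    by (rule h.injectivity)
  moreover have "proots (\<Prod>a\<leftarrow>xs. [:- a, 1:]) = mset xs" for xs :: "real list"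
  proof (induction xs)
    case (Cons a xs)
    have "(\<Prod>a\<leftarrow>xs. [:- a, 1:]) \<noteq> 0" by (auto simp: prod_list_zero_iff)
    then show ?case
      using Cons by (simp add: proots_mult del: mult_pCons_left)
  qed simp
  ultimately have "mset (eigenvalues_desc A) = mset (map Re as)"
    by (simp only: eigenvalues_desc_def mset_rev mset_sorted_list_of_multiset)
  then show ?thesis using as(2) by (metis length_map mset_eq_length)
qed

lemma length_laplacian_eigenvalues:
  "length (eigenvalues_desc (laplacian_matrix vs E)) = length vs"
  by (rule length_eigenvalues_symmetric)
    (auto simp: laplacian_matrix_def degree_matrix_def adjacency_matrix_def insert_commute
      intro!: eq_matI)

end

theory Submission
  imports Defs
begin

text \<open>Let the vertex set be split into a clique \<open>K\<close> of size \<open>c\<close> and an independent set \<open>I\<close>, with \<open>e\<close>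
  edges between them. The Laplacian has an invariant subspace \<open>{(x, - W x)}\<close> carrying its \<open>c\<close> largest
  eigenvalues such that \<open>W\<close> is nonnegative with column sums 1: subspace iteration preserves this
  property, because the inverse of an M-matrix is nonnegative. Computing the trace on this subspace
  gives \<open>c\<^sup>2 - c + e + tr (B W)\<close>, where \<open>B\<close> is the adjacency matrix between \<open>K\<close> and \<open>I\<close>, and
  \<open>tr (B W) \<le> c\<close>. This is the case \<open>k = c\<close>; since all later eigenvalues are at most \<open>c\<close>, the bound
  is strict for \<open>k > c\<close>, and the case \<open>k < c\<close> follows by passing to the complement. If equality holds,
  \<open>W\<close> and \<open>B\<^sup>T\<close> have the same support, and the Riccati equation for \<open>W\<close> then forces the
  neighbourhoods to be nested, so that the graph is threshold. Conversely, the spectrum of a threshold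
  graph is computed along its construction.\<close>


subsection \<open>Linear systems and orthonormal families\<close>

text \<open>Writing an eigenvalue sum as a maximum over orthonormal frames is of little help for an
  upper bound, since every frame would have to be controlled. Since m = c(c - 1)/2 + e, the
  resulting c^2 + e is exactly m + binom(c + 1, 2).

  Two obstacles shape the construction of \<open>W\<close>: a priori the dominant subspace need not
  be a graph over the functions on \<open>K\<close>, and a multiple eigenvalue at the cut makes it
  non-unique. Both disappear when the subspace is built as a limit of graphs whose weights stay in a
  compact set. Iterating with the Laplacian plus 1 keeps the map injective and makes the M-matrix
  strictly dominant by columns even at vertices of \<open>K\<close> without neighbours in
  \<open>I\<close>.

  Equality leaves the two possibilities c = k and c = k + 1, reflecting that a split partition need
  not be unique; each leads to clique number k + 1.\<close>

lemma two_sided_inverse: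
  fixes X :: "'i \<Rightarrow> 'j \<Rightarrow> real"
  assumes I: "finite I" and J: "finite J" and c: "card I = card J"
    and triv: "\<forall>z. (\<forall>i\<in>I. (\<Sum>j\<in>J. X i j * z j) = 0) \<longrightarrow> (\<forall>j\<in>J. z j = 0)"
  shows "\<exists>Y. (\<forall>i\<in>I. \<forall>i'\<in>I. (\<Sum>j\<in>J. X i j * Y j i') = (if i = i' then 1 else 0)) \<and>
    (\<forall>j\<in>J. \<forall>j'\<in>J. (\<Sum>i\<in>I. Y j i * X i j') = (if j = j' then 1 else 0))"
proof -
  define n where "n = card J"
  obtain f where f: "bij_betw f {0..<n} I"
    using ex_bij_betw_nat_finite[OF I] c n_def by auto
  obtain g where g: "bij_betw g {0..<n} J"
    using ex_bij_betw_nat_finite[OF J] n_def by auto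
  define f' where "f' = the_inv_into {0..<n} f"
  define g' where "g' = the_inv_into {0..<n} g"
  have f': "f' i < n" "f (f' i) = i" if "i \<in> I" for i
    using f that unfolding f'_def bij_betw_def
    by (metis atLeastLessThan_iff the_inv_into_into order_refl, metis f_the_inv_into_f)
  have g': "g' i < n" "g (g' i) = i" if "i \<in> J" for i
    using g that unfolding g'_def bij_betw_def
    by (metis atLeastLessThan_iff the_inv_into_into order_refl, metis f_the_inv_into_f)
  have f'f: "f' (f a) = a" if "a < n" for a
    using f that unfolding f'_def bij_betw_def by (simp add: the_inv_into_f_f)
  have g'g: "g' (g a) = a" if "a < n" for a
    using g that unfolding g'_def bij_betw_def by (simp add: the_inv_into_f_f)
  have sumI: "(\<Sum>i\<in>I. h i) = (\<Sum>a<n. h (f a))" for h :: "'i \<Rightarrow> real"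
    using sum.reindex_bij_betw[OF f, of h] by (simp add: lessThan_atLeast0)
  have sumJ: "(\<Sum>i\<in>J. h i) = (\<Sum>a<n. h (g a))" for h :: "'j \<Rightarrow> real"
    using sum.reindex_bij_betw[OF g, of h] by (simp add: lessThan_atLeast0)
  \<comment> \<open>Numbering both index sets gives access to determinants; users of the result keep
    vertices and eigenvalue numbers as indices.\<close>
  define A where "A = mat n n (\<lambda>(a, b). X (f a) (g b))"
  have A: "A \<in> carrier_mat n n" by (simp add: A_def)
  have "det A \<noteq> 0"
  proof
    assume "det A = 0"
    then obtain v where v: "v \<in> carrier_vec n" "v \<noteq> 0\<^sub>v n" "A *\<^sub>v v = 0\<^sub>v n"
      using det_0_iff_vec_prod_zero_field[OF A] by blast
    have "\<forall>j\<in>J. v $ g' j = 0"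
    proof (rule triv[THEN spec, THEN mp], rule ballI)
      fix i assume i: "i \<in> I"
      have "(A *\<^sub>v v) $ f' i = 0" using v f'[OF i] by simp
      moreover have "(A *\<^sub>v v) $ f' i = (\<Sum>b<n. X i (g b) * v $ b)"
        using f'[OF i] v(1) by (simp add: A_def scalar_prod_def lessThan_atLeast0)
      ultimately show "(\<Sum>j\<in>J. X i j * v $ g' j) = 0"
        by (simp add: sumJ g'g)
    qed
    then have "v $ b = 0" if "b < n" for b
      using g'g[OF that] g that by (metis atLeast0LessThan bij_betwE lessThan_iff)
    then have "v = 0\<^sub>v n" using v(1) by (intro eq_vecI) auto
    with v(2) show False by simp
  qed
  from det_non_zero_imp_unit[OF A this, of "()"] obtain B where
    B: "B \<in> carrier_mat n n" "B * A = 1\<^sub>m n" "A * B = 1\<^sub>m n"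
    unfolding Units_def ring_mat_def by auto
  show ?thesis
  proof (intro exI[of _ "\<lambda>j i. B $$ (g' j, f' i)"] conjI ballI)
    fix i i' assume i: "i \<in> I" "i' \<in> I"
    have "(A * B) $$ (f' i, f' i') = (\<Sum>a<n. X i (g a) * B $$ (a, f' i'))"
      using f' i B(1) by (simp add: A_def scalar_prod_def lessThan_atLeast0)
    then show "(\<Sum>j\<in>J. X i j * B $$ (g' j, f' i')) = (if i = i' then 1 else 0)"
      using f'[OF i(1)] f'[OF i(2)] by (simp add: sumJ g'g B(3)) metis
  next
    fix j j' assume j: "j \<in> J" "j' \<in> J"
    have "(B * A) $$ (g' j, g' j') = (\<Sum>a<n. B $$ (g' j, a) * X (f a) j')"
      using g' j B(1) by (simp add: A_def scalar_prod_def lessThan_atLeast0)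
    then show "(\<Sum>i\<in>I. B $$ (g' j, f' i) * X i j') = (if j = j' then 1 else 0)"
      using g'[OF j(1)] g'[OF j(2)] by (simp add: sumI f'f B(2)) metis
  qed
qed

text \<open>Take a square subsystem with as many columns as equations. Either it already has a
  kernel vector, or it is invertible and can be solved against one further column
  \<open>j0\<close>.\<close>

lemma underdetermined_system:
  fixes X :: "'i \<Rightarrow> 'j \<Rightarrow> real"
  assumes I: "finite I" and J: "finite J" and c: "card I < card J"
  obtains z where "\<And>i. i \<in> I \<Longrightarrow> (\<Sum>j\<in>J. X i j * z j) = 0" "\<exists>j\<in>J. z j \<noteq> 0"
proof -
  obtain J' where J': "J' \<subseteq> J" "card J' = card I" "finite J'"
    using obtain_subset_with_card_n[of "card I" J] c by auto
  have ext: "(\<Sum>j\<in>J. X i j * (if j \<in> J' then z j else 0)) = (\<Sum>j\<in>J'. X i j * z j)" for i z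
    using J J' by (intro sum.mono_neutral_cong_right) auto
  show thesis
  proof (cases "\<forall>z. (\<forall>i\<in>I. (\<Sum>j\<in>J'. X i j * z j) = 0) \<longrightarrow> (\<forall>j\<in>J'. z j = 0)")
    case True
    from two_sided_inverse[OF I J'(3) J'(2)[symmetric] True]
    obtain Y where Y: "\<forall>i\<in>I. \<forall>i'\<in>I. (\<Sum>j\<in>J'. X i j * Y j i') = (if i = i' then 1 else 0)"
      by (elim exE conjE)
    have "J' \<noteq> J" using J'(2) c by auto
    then obtain j0 where j0: "j0 \<in> J" "j0 \<notin> J'"
      using J'(1) by blast
    define z where "z j = (if j = j0 then 1 else if j \<in> J' then - (\<Sum>i\<in>I. Y j i * X i j0) else 0)" for j
    show thesis
    proof (rule that[of z])
      fix i assume i: "i \<in> I"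
      have "(\<Sum>j\<in>J. X i j * z j) = (\<Sum>j\<in>insert j0 J'. X i j * z j)"
        using J J' j0 by (intro sum.mono_neutral_right) (auto simp: z_def)
      also have "\<dots> = X i j0 + (\<Sum>j\<in>J'. X i j * - (\<Sum>i'\<in>I. Y j i' * X i' j0))"
        using J' j0 by (auto simp: z_def intro!: sum.cong)
      also have "(\<Sum>j\<in>J'. X i j * - (\<Sum>i'\<in>I. Y j i' * X i' j0))
          = - (\<Sum>j\<in>J'. \<Sum>i'\<in>I. X i j * Y j i' * X i' j0)"
        by (simp add: sum_negf sum_distrib_left mult.assoc)
      also have "(\<Sum>j\<in>J'. \<Sum>i'\<in>I. X i j * Y j i' * X i' j0)
          = (\<Sum>i'\<in>I. (\<Sum>j\<in>J'. X i j * Y j i') * X i' j0)"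
        by (subst sum.swap) (simp add: sum_distrib_right)
      also have "\<dots> = (\<Sum>i'\<in>I. if i = i' then X i' j0 else 0)"
        using i by (intro sum.cong) (auto simp: Y)
      also have "\<dots> = X i j0" using i I by simp
      finally show "(\<Sum>j\<in>J. X i j * z j) = 0" by simp
    qed (use j0 in \<open>auto simp: z_def\<close>)
  next
    case False
    then obtain z where z: "\<forall>i\<in>I. (\<Sum>j\<in>J'. X i j * z j) = 0" "\<exists>j\<in>J'. z j \<noteq> 0" by blast
    show thesis
      by (rule that[of "\<lambda>j. if j \<in> J' then z j else 0"]) (use z J'(1) in \<open>auto simp: ext\<close>)
  qed
qed

definition orthonormal_on :: "'a set \<Rightarrow> nat \<Rightarrow> (nat \<Rightarrow> 'a \<Rightarrow> real) \<Rightarrow> bool" where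
  "orthonormal_on V n v \<longleftrightarrow>
     (\<forall>i<n. \<forall>j<n. (\<Sum>u\<in>V. v i u * v j u) = (if i = j then 1 else 0))"

lemma orthonormal_onD:
  "orthonormal_on V n v \<Longrightarrow> i < n \<Longrightarrow> j < n \<Longrightarrow> (\<Sum>u\<in>V. v i u * v j u) = (if i = j then 1 else 0)"
  by (simp add: orthonormal_on_def)

lemma orthonormal_combination_coeff:
  assumes V: "finite V" and o: "orthonormal_on V n v" and J: "J \<subseteq> {..<n}" and i: "i < n"
  shows "(\<Sum>u\<in>V. v i u * (\<Sum>j\<in>J. z j * v j u)) = (if i \<in> J then z i else 0)"
proof -
  have J': "finite J" using J finite_subset by blast
  have "(\<Sum>u\<in>V. v i u * (\<Sum>j\<in>J. z j * v j u)) = (\<Sum>j\<in>J. z j * (\<Sum>u\<in>V. v i u * v j u))"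
    by (simp add: sum_distrib_left, subst sum.swap) (simp add: algebra_simps)
  also have "\<dots> = (\<Sum>j\<in>J. if i = j then z j else 0)"
    using J i by (intro sum.cong refl) (auto simp: orthonormal_onD[OF o])
  finally show ?thesis using J' by simp
qed

text \<open>A square matrix with orthonormal columns is inverted by its own transpose, so its rows
  are orthonormal as well. This gives expansions in an eigenbasis and the trace formula.\<close>

lemma orthonormal_complete:
  assumes V: "finite V" and o: "orthonormal_on V (card V) v" and u: "u \<in> V" "w \<in> V"
  shows "(\<Sum>i<card V. v i u * v i w) = (if u = w then 1 else 0)"
proof -
  let ?n = "card V"
  have "\<forall>z. (\<forall>i\<in>V. (\<Sum>j<?n. v j i * z j) = 0) \<longrightarrow> (\<forall>j\<in>{..<?n}. z j = 0)"
  proof (intro allI impI ballI)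
    fix z j
    assume z: "\<forall>i\<in>V. (\<Sum>j<?n. v j i * z j) = 0"
    assume "j \<in> {..<?n}"
    then have "z j = (\<Sum>u\<in>V. v j u * (\<Sum>j<?n. z j * v j u))"
      using orthonormal_combination_coeff[OF V o, of "{..<?n}" j z] by simp
    also have "\<dots> = 0" using z by (intro sum.neutral) (simp add: mult.commute)
    finally show "z j = 0" .
  qed
  from two_sided_inverse[OF V finite_lessThan card_lessThan[symmetric] this]
  obtain Y where Y: "\<forall>i\<in>V. \<forall>i'\<in>V. (\<Sum>j<?n. v j i * Y j i') = (if i = i' then 1 else 0)"
    by (elim exE conjE)
  have "v i w = Y i w" if i: "i < ?n" for i
  proof -
    have "v i w = (\<Sum>u\<in>V. v i u * (\<Sum>j<?n. v j u * Y j w))"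
      using V u by (simp add: Y if_distrib cong: if_cong)
    also have "\<dots> = Y i w"
      using orthonormal_combination_coeff[OF V o, of "{..<?n}" i "\<lambda>j. Y j w"] i
      by (simp add: mult.commute)
    finally show ?thesis .
  qed
  then show ?thesis using Y u by simp
qed

lemma orthonormal_expansion:
  assumes V: "finite V" and o: "orthonormal_on V (card V) v" and w: "w \<in> V"
  shows "f w = (\<Sum>i<card V. (\<Sum>u\<in>V. f u * v i u) * v i w)"
proof -
  have "(\<Sum>i<card V. (\<Sum>u\<in>V. f u * v i u) * v i w) = (\<Sum>u\<in>V. f u * (\<Sum>i<card V. v i u * v i w))"
    by (simp add: sum_distrib_left sum_distrib_right mult.assoc, subst sum.swap) simp
  also have "\<dots> = (\<Sum>u\<in>V. if u = w then f u else 0)"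
    using w by (intro sum.cong) (auto simp: orthonormal_complete[OF V o])
  finally show ?thesis using V w by simp
qed

subsection \<open>Symmetric operators on functions\<close>

text \<open>Bolzano-Weierstrass, one coordinate at a time. It is needed twice: to attain the maximum
  of a quadratic form, and to extract limiting weights from the subspace iteration.\<close>

lemma pointwise_convergent_subsequence:
  fixes X :: "nat \<Rightarrow> 'b \<Rightarrow> real"
  assumes "finite S" "\<And>t s. s \<in> S \<Longrightarrow> \<bar>X t s\<bar> \<le> 1"
  shows "\<exists>r l. strict_mono (r :: nat \<Rightarrow> nat) \<and> (\<forall>s\<in>S. (\<lambda>t. X (r t) s) \<longlonglongrightarrow> l s)"
  using assms
proof (induction S)
  case empty
  then show ?case using strict_mono_id by blast
next
  case (insert a S)
  then obtain r l where r: "strict_mono r" "\<forall>s\<in>S. (\<lambda>t. X (r t) s) \<longlonglongrightarrow> l s"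
    by force
  obtain f where f: "strict_mono f" "monoseq (\<lambda>t. X (r (f t)) a)"
    using seq_monosub[of "\<lambda>t. X (r t) a"] by auto
  have "Bseq (\<lambda>t. X (r (f t)) a)"
    using insert.prems by (intro BseqI'[of _ 1]) auto
  then obtain b where b: "(\<lambda>t. X (r (f t)) a) \<longlonglongrightarrow> b"
    using Bseq_monoseq_convergent[OF _ f(2)] by (auto simp: convergent_def)
  have "(\<lambda>t. X (r (f t)) s) \<longlonglongrightarrow> l s" if "s \<in> S" for s
    using LIMSEQ_subseq_LIMSEQ[OF r(2)[rule_format, OF that] f(1)] by (simp add: o_def)
  then show ?case
    using b insert.hyps strict_mono_o[OF r(1) f(1), unfolded o_def]
    by (intro exI[of _ "r \<circ> f"] exI[of _ "l(a := b)"]) auto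
qed

definition ip :: "'a set \<Rightarrow> ('a \<Rightarrow> real) \<Rightarrow> ('a \<Rightarrow> real) \<Rightarrow> real" where
  "ip V f g = (\<Sum>u\<in>V. f u * g u)"

definition mat_app :: "'a set \<Rightarrow> ('a \<Rightarrow> 'a \<Rightarrow> real) \<Rightarrow> ('a \<Rightarrow> real) \<Rightarrow> 'a \<Rightarrow> real" where
  "mat_app V M f u = (\<Sum>w\<in>V. M u w * f w)"

lemma ip_commute: "ip V f g = ip V g f"
  by (simp add: ip_def mult.commute)

lemma ip_cong: "(\<And>u. u \<in> V \<Longrightarrow> f u = f' u) \<Longrightarrow> (\<And>u. u \<in> V \<Longrightarrow> g u = g' u) \<Longrightarrow> ip V f g = ip V f' g'"
  by (simp add: ip_def)

lemma ip_add_right: "ip V f (\<lambda>u. g u + h u) = ip V f g + ip V f h"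
  by (simp add: ip_def sum.distrib algebra_simps)

lemma ip_add_left: "ip V (\<lambda>u. g u + h u) f = ip V g f + ip V h f"
  by (simp add: ip_def sum.distrib algebra_simps)

lemma ip_scale_right: "ip V f (\<lambda>u. c * g u) = c * ip V f g"
  by (simp add: ip_def sum_distrib_left algebra_simps)

lemma ip_scale_left: "ip V (\<lambda>u. c * g u) f = c * ip V g f"
  by (simp add: ip_def sum_distrib_left algebra_simps)

lemma ip_sum_right: "ip V f (\<lambda>u. \<Sum>i\<in>A. g i u) = (\<Sum>i\<in>A. ip V f (g i))"
  unfolding ip_def by (subst sum.swap) (simp add: sum_distrib_left)

lemma ip_self_nonneg: "0 \<le> ip V f f"
  by (simp add: ip_def sum_nonneg)

lemma ip_self_eq_0: "finite V \<Longrightarrow> ip V f f = 0 \<longleftrightarrow> (\<forall>u\<in>V. f u = 0)"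
  by (simp add: ip_def sum_nonneg_eq_0_iff)

lemma orthonormal_on_ip:
  "orthonormal_on V n v \<longleftrightarrow> (\<forall>i<n. \<forall>j<n. ip V (v i) (v j) = (if i = j then 1 else 0))"
  by (simp add: orthonormal_on_def ip_def)

lemma mat_app_add: "mat_app V M (\<lambda>u. g u + h u) = (\<lambda>u. mat_app V M g u + mat_app V M h u)"
  by (simp add: mat_app_def sum.distrib algebra_simps fun_eq_iff)

lemma mat_app_scale: "mat_app V M (\<lambda>u. c * g u) = (\<lambda>u. c * mat_app V M g u)"
  by (simp add: mat_app_def sum_distrib_left algebra_simps fun_eq_iff)

lemma ip_mat_app_commute:
  assumes "\<forall>u\<in>V. \<forall>w\<in>V. M u w = M w u"
  shows "ip V f (mat_app V M g) = ip V (mat_app V M f) g"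
proof -
  have "ip V f (mat_app V M g) = (\<Sum>u\<in>V. \<Sum>w\<in>V. M u w * f u * g w)"
    by (simp add: ip_def mat_app_def sum_distrib_left algebra_simps)
  also have "\<dots> = (\<Sum>u\<in>V. \<Sum>w\<in>V. M w u * f w * g u)"
    by (rule sum.swap)
  also have "\<dots> = (\<Sum>u\<in>V. \<Sum>w\<in>V. M u w * f w * g u)"
    by (intro sum.cong refl) (simp add: assms)
  also have "\<dots> = ip V (mat_app V M f) g"
    by (simp add: ip_def mat_app_def sum_distrib_right)
  finally show ?thesis .
qed

text \<open>The first-order condition at a maximum in a form without derivatives: for small
  \<open>e\<close> the linear term would outweigh the quadratic one.\<close>

lemma linear_term_zero_of_quadratic_le:
  fixes a b :: real
  assumes "\<And>e. 2 * e * a + e\<^sup>2 * b \<le> 0"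
  shows "a = 0"
proof (rule ccontr)
  assume a: "a \<noteq> 0"
  \<comment> \<open>The sign of \<open>e\<close> is that of \<open>a\<close>, and its size makes the
    linear term 2 e^2 (|b| + 1), which exceeds e^2 |b|.\<close>
  define e where "e = a / (\<bar>b\<bar> + 1)"
  have e: "e * (\<bar>b\<bar> + 1) = a" by (simp add: e_def)
  have "- (e\<^sup>2 * b) \<le> e\<^sup>2 * \<bar>b\<bar>"
    by (metis abs_ge_minus_self minus_mult_right mult_left_mono zero_le_power2)
  moreover have "2 * e * a = 2 * (e\<^sup>2 * \<bar>b\<bar>) + 2 * e\<^sup>2"
    unfolding e[symmetric] by (simp add: power2_eq_square algebra_simps)
  moreover have "e\<^sup>2 > 0" "e\<^sup>2 * \<bar>b\<bar> \<ge> 0"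
    using a by (auto simp: e_def)
  ultimately show False using assms[of e] by linarith
qed

text \<open>Maximise the quadratic form on unit functions orthogonal to all \<open>g i\<close>. In
  general the residual of a maximiser \<open>f\<close> would only lie in the span of the
  \<open>g i\<close>; by \<open>inv\<close> the residual itself satisfies the constraints, so
  \<open>f\<close> may be perturbed along it. The first variation in that direction is the squared
  norm of the residual, which therefore vanishes.\<close>

lemma constrained_extremal_eigenvector:
  fixes M :: "'a \<Rightarrow> 'a \<Rightarrow> real" and g :: "nat \<Rightarrow> 'a \<Rightarrow> real"
  assumes V: "finite V" and sym: "\<forall>u\<in>V. \<forall>w\<in>V. M u w = M w u"
    and k: "k < card V"
    and inv: "\<forall>f. (\<forall>i<k. ip V (g i) f = 0) \<longrightarrow> (\<forall>i<k. ip V (g i) (mat_app V M f) = 0)"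
  shows "\<exists>f \<mu>. ip V f f = 1 \<and> (\<forall>i<k. ip V (g i) f = 0) \<and>
    (\<forall>u\<in>V. mat_app V M f u = \<mu> * f u) \<and>
    (\<forall>h. (\<forall>i<k. ip V (g i) h = 0) \<longrightarrow> ip V h (mat_app V M h) \<le> \<mu> * ip V h h)"
proof -
  define S where "S = {f. ip V f f = 1 \<and> (\<forall>i<k. ip V (g i) f = 0)}"
  define Q where "Q f = ip V f (mat_app V M f)" for f
  have scaleQ: "Q (\<lambda>u. c * f u) = c\<^sup>2 * Q f" for c f
    by (simp add: Q_def mat_app_scale ip_scale_left ip_scale_right power2_eq_square)
  have normalize: "(\<lambda>u. 1 / sqrt (ip V f f) * f u) \<in> S"
    if "\<exists>u\<in>V. f u \<noteq> 0" "\<forall>i<k. ip V (g i) f = 0" for f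
  proof -
    have "ip V f f > 0"
      using that(1) ip_self_nonneg[of V f] ip_self_eq_0[OF V, of f] by (auto simp: less_le)
    then have "(1 / sqrt (ip V f f)) * ((1 / sqrt (ip V f f)) * ip V f f) = 1"
      by (simp add: field_simps)
    then show ?thesis using that(2) unfolding S_def mem_Collect_eq
      by (simp only: ip_scale_left ip_scale_right) simp
  qed
  \<comment> \<open>Fewer constraints than vertices leave a nonzero admissible function, so the
    maximum is over a nonempty set.\<close>
  obtain z where z: "\<And>i. i \<in> {..<k} \<Longrightarrow> (\<Sum>u\<in>V. g i u * z u) = 0" "\<exists>u\<in>V. z u \<noteq> 0"
    using underdetermined_system[of "{..<k}" V g] V k by auto
  have S0: "S \<noteq> {}" using normalize[of z] z by (auto simp: ip_def)
  have S1: "\<bar>f u\<bar> \<le> 1" if "f \<in> S" "u \<in> V" for f u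
  proof -
    have "(f u)\<^sup>2 \<le> (\<Sum>u\<in>V. (f u)\<^sup>2)"
      using V that(2) by (intro member_le_sum) auto
    also have "\<dots> = 1" using that by (simp add: S_def ip_def power2_eq_square)
    finally show ?thesis by (simp add: abs_square_le_1)
  qed
  have Qbd: "Q f \<le> (\<Sum>u\<in>V. \<Sum>w\<in>V. \<bar>M u w\<bar>)" if "f \<in> S" for f
  proof -
    have "Q f = (\<Sum>u\<in>V. \<Sum>w\<in>V. M u w * (f u * f w))"
      by (simp add: Q_def ip_def mat_app_def sum_distrib_left algebra_simps)
    also have "\<dots> \<le> (\<Sum>u\<in>V. \<Sum>w\<in>V. \<bar>M u w\<bar>)"
    proof (intro sum_mono)
      fix u w assume uw: "u \<in> V" "w \<in> V"
      have "\<bar>f u * f w\<bar> \<le> 1"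
        using S1[OF that uw(1)] S1[OF that uw(2)] by (simp add: abs_mult mult_le_one)
      then have "\<bar>M u w\<bar> * \<bar>f u * f w\<bar> \<le> \<bar>M u w\<bar>" by (simp add: mult_left_le)
      then show "M u w * (f u * f w) \<le> \<bar>M u w\<bar>"
        by (metis abs_ge_self abs_mult order_trans)
    qed
    finally show ?thesis .
  qed
  have bdd: "bdd_above (Q ` S)" using Qbd by (auto simp: bdd_above_def)
  define \<mu> where "\<mu> = Sup (Q ` S)"
  have Q_le: "Q f \<le> \<mu>" if "f \<in> S" for f
    unfolding \<mu>_def using bdd that by (auto intro: cSup_upper)
  have "\<exists>f\<in>S. \<mu> - 1 / Suc t < Q f" for t
    using less_cSupD[of "Q ` S" "\<mu> - 1 / Suc t"] S0 by (auto simp: \<mu>_def)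
  then obtain F where F: "\<And>t. F t \<in> S" "\<And>t. \<mu> - 1 / Suc t < Q (F t)" by metis
  obtain r f where r: "strict_mono r" and lim: "\<forall>u\<in>V. (\<lambda>t. F (r t) u) \<longlonglongrightarrow> f u"
    using pointwise_convergent_subsequence[OF V, of F] S1 F(1) by blast
  have "(\<lambda>t. ip V (F (r t)) (F (r t))) \<longlonglongrightarrow> ip V f f"
    unfolding ip_def using lim by (intro tendsto_intros) auto
  moreover have "ip V (F (r t)) (F (r t)) = 1" for t using F(1)[of "r t"] by (simp add: S_def)
  ultimately have f1: "ip V f f = 1" by (simp add: LIMSEQ_const_iff)
  have fg: "ip V (g i) f = 0" if "i < k" for i
  proof -
    have "(\<lambda>t. ip V (g i) (F (r t))) \<longlonglongrightarrow> ip V (g i) f"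
      unfolding ip_def using lim by (intro tendsto_intros) auto
    moreover have "ip V (g i) (F (r t)) = 0" for t using F(1)[of "r t"] that by (simp add: S_def)
    ultimately show ?thesis by (simp add: LIMSEQ_const_iff)
  qed
  have fS: "f \<in> S" using f1 fg by (simp add: S_def)
  have "(\<lambda>t. Q (F (r t))) \<longlonglongrightarrow> Q f"
    unfolding Q_def ip_def mat_app_def using lim by (intro tendsto_intros) auto
  moreover have "(\<lambda>t. \<mu> - 1 / Suc (r t)) \<longlonglongrightarrow> \<mu> - 0"
    using LIMSEQ_subseq_LIMSEQ[OF LIMSEQ_Suc[OF lim_1_over_n] r]
    by (intro tendsto_intros) (simp add: o_def)
  ultimately have "\<mu> - 0 \<le> Q f"
    using F(2) by (intro LIMSEQ_le) (auto intro: less_imp_le)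
  then have Qf: "Q f = \<mu>" using Q_le[OF fS] by simp
  have upper: "Q h \<le> \<mu> * ip V h h" if h: "\<And>i. i < k \<Longrightarrow> ip V (g i) h = 0" for h
  proof (cases "\<exists>u\<in>V. h u \<noteq> 0")
    case True
    have "ip V h h > 0"
      using True ip_self_nonneg[of V h] ip_self_eq_0[OF V, of h] by (auto simp: less_le)
    moreover from Q_le[OF normalize[OF True]] h
    have "(1 / sqrt (ip V h h))\<^sup>2 * Q h \<le> \<mu>" by (simp only: scaleQ) blast
    ultimately show ?thesis by (simp add: power_divide field_simps)
  next
    case False
    then have "Q h = 0" "ip V h h = 0" by (auto simp: Q_def ip_def)
    then show ?thesis by simp
  qed
  define d where "d = (\<lambda>u. mat_app V M f u + (- \<mu>) * f u)"
  have dg: "ip V (g i) d = 0" if "i < k" for i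
    unfolding d_def ip_add_right ip_scale_right using that fg inv by simp
  have "ip V d d = 0"
  proof (rule linear_term_zero_of_quadratic_le)
    fix e :: real
    define h where "h = (\<lambda>u. f u + e * d u)"
    have "ip V (g i) h = 0" if "i < k" for i
      unfolding h_def ip_add_right ip_scale_right using dg fg that by simp
    from upper[OF this] have "Q h \<le> \<mu> * ip V h h" .
    moreover have "Q h = Q f + 2 * e * ip V d (mat_app V M f) + e\<^sup>2 * Q d"
    proof -
      have "ip V f (mat_app V M d) = ip V d (mat_app V M f)"
        using ip_mat_app_commute[of V M f d, OF sym] ip_commute[of V "mat_app V M f" d] by simp
      moreover have "Q h = Q f + e * ip V f (mat_app V M d)
          + (e * ip V d (mat_app V M f) + e * (e * Q d))"
        unfolding Q_def h_def mat_app_add mat_app_scale ip_add_left ip_add_right ip_scale_left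
          ip_scale_right by (simp only: distrib_left add.assoc)
      ultimately show ?thesis by (simp add: power2_eq_square)
    qed
    moreover have "ip V h h = ip V f f + 2 * e * ip V d f + e\<^sup>2 * ip V d d"
      unfolding h_def ip_add_left ip_add_right ip_scale_left ip_scale_right ip_commute[of V f d]
      by (simp add: power2_eq_square algebra_simps)
    moreover have "ip V d d = ip V d (mat_app V M f) - \<mu> * ip V d f"
    proof -
      have "ip V d d = ip V d (\<lambda>u. mat_app V M f u + (- \<mu>) * f u)"
        by (subst (2) d_def) (rule refl)
      then show ?thesis unfolding ip_add_right ip_scale_right by simp
    qed
    ultimately show "2 * e * ip V d d + e\<^sup>2 * (Q d - \<mu> * ip V d d) \<le> 0"
    proof -
      assume le: "Q h \<le> \<mu> * ip V h h"
        and Qh: "Q h = Q f + 2 * e * ip V d (mat_app V M f) + e\<^sup>2 * Q d"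
        and hh: "ip V h h = ip V f f + 2 * e * ip V d f + e\<^sup>2 * ip V d d"
        and dd: "ip V d d = ip V d (mat_app V M f) - \<mu> * ip V d f"
      have "2 * e * ip V d d = 2 * e * ip V d (mat_app V M f) - 2 * e * (\<mu> * ip V d f)"
        by (subst dd) (simp add: right_diff_distrib)
      moreover have "\<mu> * ip V h h = \<mu> + 2 * e * (\<mu> * ip V d f) + e\<^sup>2 * (\<mu> * ip V d d)"
        unfolding hh f1 by (simp add: distrib_left mult.left_commute)
      moreover have "e\<^sup>2 * (Q d - \<mu> * ip V d d) = e\<^sup>2 * Q d - e\<^sup>2 * (\<mu> * ip V d d)"
        by (simp add: right_diff_distrib)
      ultimately show ?thesis using le Qh Qf by linarith
    qed
  qed
  then have d0: "\<forall>u\<in>V. d u = 0" using ip_self_eq_0[OF V] by blast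
  have "mat_app V M f u = \<mu> * f u" if "u \<in> V" for u
    using bspec[OF d0 that] by (simp add: d_def)
  then show ?thesis
    using f1 fg upper by (intro exI[of _ f] exI[of _ \<mu>]) (auto simp: Q_def)
qed

text \<open>The prescribed vector \<open>h\<close> has to be the last basis vector even if the
  eigenvalue 0 is multiple, as for a disconnected graph. It is therefore imposed as a constraint
  from the start and appended at the end, where positive semidefiniteness puts its eigenvalue in the
  right place.\<close>

lemma spectral_theorem_with_kernel_vector:
  fixes M :: "'a \<Rightarrow> 'a \<Rightarrow> real"
  assumes V: "finite V" and sym: "\<forall>u\<in>V. \<forall>w\<in>V. M u w = M w u"
    and psd: "\<And>f. 0 \<le> ip V f (mat_app V M f)"
    and h: "ip V h h = 1" "\<And>u. u \<in> V \<Longrightarrow> mat_app V M h u = 0"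
  shows "\<exists>v l. orthonormal_on V (card V) v \<and>
    (\<forall>i<card V. \<forall>u\<in>V. mat_app V M (v i) u = l i * v i u) \<and>
    (\<forall>i j. i \<le> j \<longrightarrow> j < card V \<longrightarrow> l j \<le> l i) \<and> v (card V - 1) = h"
proof -
  have "card V \<noteq> 0" using h(1) V by (auto simp: ip_def)
  \<comment> \<open>The last clause records extremality; applied to a later eigenvector it yields
    the decreasing order. Stopping at \<open>card V - 1\<close> vectors leaves room for
    \<open>h\<close>.\<close>
  have claim: "\<exists>v l. orthonormal_on V k v \<and> (\<forall>i<k. ip V h (v i) = 0) \<and>
      (\<forall>i<k. \<forall>u\<in>V. mat_app V M (v i) u = l i * v i u) \<and>
      (\<forall>i<k. \<forall>f. ip V h f = 0 \<longrightarrow> (\<forall>j<i. ip V (v j) f = 0) \<longrightarrow>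
        ip V f (mat_app V M f) \<le> l i * ip V f f)" if "k < card V" for k
    using that
  proof (induction k)
    case 0
    then show ?case by (simp add: orthonormal_on_def)
  next
    case (Suc k)
    from Suc_lessD[OF Suc.prems, THEN Suc.IH]
    obtain v l where o: "orthonormal_on V k v" and hv: "\<forall>i<k. ip V h (v i) = 0"
      and eig: "\<forall>i<k. \<forall>u\<in>V. mat_app V M (v i) u = l i * v i u"
      and mx: "\<forall>i<k. \<forall>f. ip V h f = 0 \<longrightarrow> (\<forall>j<i. ip V (v j) f = 0) \<longrightarrow>
        ip V f (mat_app V M f) \<le> l i * ip V f f"
      by (elim exE conjE)
    \<comment> \<open>The constraints are the \<open>k\<close> vectors already found, with
      \<open>h\<close> in the free slot \<open>k\<close>.\<close>
    define g where "g i = (if i = k then h else v i)" for i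
    have inv: "\<forall>f. (\<forall>i<Suc k. ip V (g i) f = 0) \<longrightarrow> (\<forall>i<Suc k. ip V (g i) (mat_app V M f) = 0)"
    proof (intro allI impI)
      fix f i assume f: "\<forall>i<Suc k. ip V (g i) f = 0" and i: "i < Suc k"
      have "ip V (g i) (mat_app V M f) = ip V (mat_app V M (g i)) f"
        by (rule ip_mat_app_commute[OF sym])
      also have "\<dots> = ip V (\<lambda>u. (if i = k then 0 else l i) * g i u) f"
        using i by (intro ip_cong) (auto simp: g_def h(2) eig)
      finally show "ip V (g i) (mat_app V M f) = 0"
        using f i by (simp only: ip_scale_left)
    qed
    from constrained_extremal_eigenvector[OF V sym Suc.prems inv]
    obtain f \<mu> where f: "ip V f f = 1" "\<forall>i<Suc k. ip V (g i) f = 0"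
      "\<forall>u\<in>V. mat_app V M f u = \<mu> * f u"
      "\<forall>h. (\<forall>i<Suc k. ip V (g i) h = 0) \<longrightarrow> ip V h (mat_app V M h) \<le> \<mu> * ip V h h"
      by (elim exE conjE)
    have vf: "ip V (v i) f = 0" if "i < k" for i using f(2)[THEN spec, of i] that by (simp add: g_def)
    have hf: "ip V h f = 0" using f(2)[THEN spec, of k] by (simp add: g_def)
    have fv: "ip V f (v i) = 0" if "i < k" for i using vf[OF that] ip_commute[of V f "v i"] by simp
    have "orthonormal_on V (Suc k) (v(k := f))"
      using o f(1) vf fv by (simp add: orthonormal_on_ip less_Suc_eq)
    moreover have "\<forall>i<Suc k. ip V h ((v(k := f)) i) = 0"
      using hv hf by (simp add: less_Suc_eq)
    moreover have "\<forall>i<Suc k. \<forall>u\<in>V. mat_app V M ((v(k := f)) i) u = (l(k := \<mu>)) i * (v(k := f)) i u"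
      using eig f(3) by (simp add: less_Suc_eq)
    moreover have "\<forall>i<Suc k. \<forall>y. ip V h y = 0 \<longrightarrow> (\<forall>j<i. ip V ((v(k := f)) j) y = 0) \<longrightarrow>
        ip V y (mat_app V M y) \<le> (l(k := \<mu>)) i * ip V y y"
    proof (intro allI impI)
      fix i y assume i: "i < Suc k" and y: "ip V h y = 0" "\<forall>j<i. ip V ((v(k := f)) j) y = 0"
      have vy: "ip V (v j) y = 0" if "j < i" for j using y(2) that i by auto
      show "ip V y (mat_app V M y) \<le> (l(k := \<mu>)) i * ip V y y"
      proof (cases "i = k")
        case True
        have "\<forall>j<Suc k. ip V (g j) y = 0" using vy y(1) True by (simp add: g_def less_Suc_eq)
        then show ?thesis using f(4) True by simp
      next
        case False
        then show ?thesis using mx i y(1) vy by simp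
      qed
    qed
    ultimately show ?case by (intro exI conjI)
  qed
  have "card V - 1 < card V" using \<open>card V \<noteq> 0\<close> by simp
  from claim[OF this]
  obtain v l where o: "orthonormal_on V (card V - 1) v"
    and hv: "\<forall>i<card V - 1. ip V h (v i) = 0"
    and eig: "\<forall>i<card V - 1. \<forall>u\<in>V. mat_app V M (v i) u = l i * v i u"
    and mx: "\<forall>i<card V - 1. \<forall>f. ip V h f = 0 \<longrightarrow> (\<forall>j<i. ip V (v j) f = 0) \<longrightarrow>
        ip V f (mat_app V M f) \<le> l i * ip V f f"
    by (elim exE conjE)
  define n where "n = card V - 1"
  have n: "card V = Suc n" using \<open>card V \<noteq> 0\<close> by (simp add: n_def)
  note o = o[folded n_def] and hv = hv[folded n_def] and eig = eig[folded n_def] and mx = mx[folded n_def]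
  have Qv: "ip V (v i) (mat_app V M (v i)) = l i" if "i < n" for i
  proof -
    have "ip V (v i) (mat_app V M (v i)) = ip V (v i) (\<lambda>u. l i * v i u)"
      using eig that by (intro ip_cong) auto
    then show ?thesis using o that by (simp add: ip_scale_right orthonormal_on_ip)
  qed
  have vv: "ip V (v i) (v j) = (if i = j then 1 else 0)" if "i < n" "j < n" for i j
    using o that by (simp add: orthonormal_on_ip)
  have vh: "ip V (v i) h = 0" if "i < n" for i
    using hv that ip_commute[of V h "v i"] by simp
  have "orthonormal_on V (card V) (v(n := h))"
    using h(1) hv vh vv by (simp add: orthonormal_on_ip n less_Suc_eq)
  moreover have "(l(n := 0)) j \<le> (l(n := 0)) i" if "i \<le> j" "j < card V" for i j
  proof (cases "j = n")
    case True
    then show ?thesis using psd[of "v i"] Qv[of i] that by auto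
  next
    case False
    then have j: "j < n" "i < n" using that n by auto
    then have "ip V (v j) (mat_app V M (v j)) \<le> l i * ip V (v j) (v j)"
      using hv vv that(1) j by (intro mx[rule_format]) auto
    then show ?thesis using j Qv vv by simp
  qed
  moreover have "\<forall>i<card V. \<forall>u\<in>V. mat_app V M ((v(n := h)) i) u = (l(n := 0)) i * (v(n := h)) i u"
    using eig h(2) by (simp add: n less_Suc_eq)
  moreover have "(v(n := h)) (card V - 1) = h" by (simp add: n)
  ultimately show ?thesis by blast
qed

text \<open>The bridge to characteristic polynomials: an orthonormal eigenbasis makes the matrix
  similar to a diagonal one. Any basis with decreasing eigenvalues determines the list, so later
  arguments may choose whichever eigenbasis suits them.\<close>

lemma eigenvalues_desc_eigenbasis:
  assumes vs: "distinct vs" "set vs = V" and n: "n = length vs" and o: "orthonormal_on V n v"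
    and eig: "\<And>i u. i < n \<Longrightarrow> u \<in> V \<Longrightarrow> mat_app V M (v i) u = l i * v i u"
    and anti: "\<And>i j. i \<le> j \<Longrightarrow> j < n \<Longrightarrow> l j \<le> l i"
  shows "eigenvalues_desc (mat n n (\<lambda>(a, b). M (vs ! a) (vs ! b))) = map l [0..<n]"
proof -
  define A where "A = mat n n (\<lambda>(a, b). M (vs ! a) (vs ! b))"
  define P where "P = mat n n (\<lambda>(a, i). v i (vs ! a))"
  define Q where "Q = mat n n (\<lambda>(i, a). v i (vs ! a))"
  define D where "D = mat n n (\<lambda>(i, j). if i = j then l i else 0)"
  have carr: "A \<in> carrier_mat n n" "P \<in> carrier_mat n n" "Q \<in> carrier_mat n n" "D \<in> carrier_mat n n"
    by (auto simp: A_def P_def Q_def D_def)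
  have sumV: "(\<Sum>a = 0..<n. f (vs ! a)) = (\<Sum>u\<in>V. f u)" for f :: "'a \<Rightarrow> real"
    using sum.reindex_bij_betw[OF bij_betw_nth[OF vs(1) refl refl], of f] vs(2) n
    by (simp add: lessThan_atLeast0)
  have vsV: "vs ! a \<in> V" if "a < n" for a using that vs n by auto
  have QP: "Q * P = 1\<^sub>m n"
    by (rule eq_matI) (auto simp: Q_def P_def scalar_prod_def sumV[of "\<lambda>u. v _ u * v _ u"]
        orthonormal_onD[OF o])
  have PQ: "P * Q = 1\<^sub>m n" by (rule mat_mult_left_right_inverse[OF carr(3,2) QP])
  have "A * P = P * D"
  proof (rule eq_matI)
    fix a i assume "a < dim_row (P * D)" "i < dim_col (P * D)"
    then have ai: "a < n" "i < n" by (auto simp: P_def D_def)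
    have "(A * P) $$ (a, i) = (\<Sum>b = 0..<n. M (vs ! a) (vs ! b) * v i (vs ! b))"
      using ai by (simp add: A_def P_def scalar_prod_def)
    also have "\<dots> = l i * v i (vs ! a)"
      using eig[OF ai(2) vsV[OF ai(1)]] sumV[of "\<lambda>u. M (vs ! a) u * v i u"] by (simp add: mat_app_def)
    also have "\<dots> = (\<Sum>j = 0..<n. v j (vs ! a) * (if j = i then l j else 0))"
      using ai by (simp add: if_distrib[of "\<lambda>x. _ * x"] cong: if_cong)
    also have "\<dots> = (P * D) $$ (a, i)"
      using ai by (simp add: D_def P_def scalar_prod_def)
    finally show "(A * P) $$ (a, i) = (P * D) $$ (a, i)" .
  qed (auto simp: A_def P_def D_def)
  then have "A = P * D * Q"
    using PQ carr by (metis assoc_mult_mat right_mult_one_mat)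
  then have "similar_mat A D"
    using similar_mat_witI[OF PQ QP _ carr(1,4,2,3)] by (auto simp: similar_mat_def)
  then have "char_poly A = char_poly D" by (rule char_poly_similar)
  also have "\<dots> = (\<Prod>a\<leftarrow>diag_mat D. [:- a, 1:])"
    by (rule char_poly_upper_triangular[OF carr(4)]) (auto simp: D_def)
  also have "diag_mat D = map l [0..<n]"
    by (auto simp: diag_mat_def D_def intro!: map_cong)
  finally have cp: "char_poly A = (\<Prod>a\<leftarrow>map l [0..<n]. [:- a, 1:])" .
  have "proots (\<Prod>a\<leftarrow>xs. [:- a, 1:]) = mset xs" for xs :: "real list"
  proof (induction xs)
    case (Cons a xs)
    have "(\<Prod>a\<leftarrow>xs. [:- a, 1:]) \<noteq> 0" by (auto simp: prod_list_zero_iff)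
    then show ?case
      using Cons by (simp add: proots_mult del: mult_pCons_left)
  qed simp
  then have "eigenvalues_desc A = rev (sort (map l [0..<n]))"
    by (simp only: eigenvalues_desc_def cp sorted_list_of_multiset_mset)
  also have "sort (map l [0..<n]) = rev (map l [0..<n])"
    by (rule properties_for_sort) (auto simp: sorted_iff_nth_mono rev_nth intro!: anti)
  finally show ?thesis by (simp add: A_def)
qed

subsection \<open>Invariant graphs of split Laplacians\<close>

lemma sum_mult_delta:
  fixes f g :: "'b \<Rightarrow> real"
  assumes "finite A" "a \<in> A"
  shows "(\<Sum>i\<in>A. f i * (if i = a then g i else 0)) = f a * g a"
    "(\<Sum>i\<in>A. (if a = i then g i else 0) * f i) = g a * f a"
proof -
  have "(\<Sum>i\<in>A. f i * (if i = a then g i else 0)) = (\<Sum>i\<in>A. if i = a then f i * g i else 0)"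
    "(\<Sum>i\<in>A. (if a = i then g i else 0) * f i) = (\<Sum>i\<in>A. if a = i then g i * f i else 0)"
    by (auto intro!: sum.cong)
  then show "(\<Sum>i\<in>A. f i * (if i = a then g i else 0)) = f a * g a"
    "(\<Sum>i\<in>A. (if a = i then g i else 0) * f i) = g a * f a"
    using assms by simp_all
qed

text \<open>This provides the starting subspace of the subspace iteration below: the span of the vectors
  \<open>e\<^sub>j - e\<^bsub>s' j\<^esub>\<close> is transversal to the orthogonal complement of the \<open>g q\<close>.\<close>

lemma transversal_choice:
  fixes g :: "'q \<Rightarrow> 'a \<Rightarrow> real"
  assumes "finite J" "finite S" "finite T" "finite I" "I \<noteq> {}" "card J \<le> card T"
    and "\<And>q j. q \<in> J \<Longrightarrow> j \<in> S \<Longrightarrow> s j \<in> I \<and> g q j = g q (s j)"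
    and "\<And>q. q \<in> J \<Longrightarrow> (\<Sum>u\<in>S \<union> T \<union> I. g q u) = 0"
  shows "\<exists>s'. (\<forall>j\<in>T. s' j \<in> I) \<and> (\<forall>\<phi>. (\<forall>j\<in>T. (\<Sum>q\<in>J. \<phi> q * g q j) = (\<Sum>q\<in>J. \<phi> q * g q (s' j)))
           \<longrightarrow> (\<forall>u\<in>S \<union> T \<union> I. (\<Sum>q\<in>J. \<phi> q * g q u) = 0))"
  using assms
proof (induction "card J" arbitrary: J S T s g)
  case 0
  then show ?case by auto
next
  case (Suc m)
  let ?V = "S \<union> T \<union> I"
  have T0: "T \<noteq> {}" using Suc.hyps(2) Suc.prems by auto
  show ?case
  proof (cases "\<forall>q\<in>J. \<forall>u\<in>?V. g q u = 0")
    case True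
    then show ?thesis using Suc.prems(5) by (auto intro!: sum.neutral)
  next
    case False
    then obtain q0 u0 where q0: "q0 \<in> J" "u0 \<in> ?V" "g q0 u0 \<noteq> 0" by blast
    \<comment> \<open>Otherwise \<open>g q0\<close> would be constant on all vertices, those in
      \<open>S\<close> being tied to partners in \<open>I\<close>; with sum 0 it would vanish,
      contrary to the choice of \<open>q0\<close>.\<close>
    have "\<exists>j\<in>T. \<exists>l\<in>I. g q0 j \<noteq> g q0 l"
    proof (rule ccontr)
      assume "\<not> ?thesis"
      then have eq: "g q0 j = g q0 l" if "j \<in> T" "l \<in> I" for j l using that by blast
      obtain j0 where j0: "j0 \<in> T" using T0 by blast
      obtain l0 where l0: "l0 \<in> I" using Suc.prems(5) by blast
      have const: "g q0 u = g q0 j0" if "u \<in> ?V" for u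
      proof -
        have T: "g q0 i = g q0 j0" if "i \<in> T" for i using eq[OF that l0] eq[OF j0 l0] by simp
        have I: "g q0 l = g q0 j0" if "l \<in> I" for l using eq[OF j0 that] by simp
        show ?thesis using that T I Suc.prems(7)[OF q0(1), of u] by auto
      qed
      have "(\<Sum>u\<in>?V. g q0 u) = (\<Sum>u\<in>?V. g q0 j0)"
        by (intro sum.cong refl const)
      then have "real (card ?V) * g q0 j0 = 0"
        using Suc.prems(8)[OF q0(1)] by simp
      moreover have "card ?V \<noteq> 0" using q0(2) Suc.prems(2-4) by auto
      ultimately show False using const[OF q0(2)] q0(3) by simp
    qed
    then obtain j l where jl: "j \<in> T" "l \<in> I" "g q0 j \<noteq> g q0 l" by blast
    \<comment> \<open>Gaussian elimination: removing the multiple \<open>k q\<close> of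
      \<open>g q0\<close> makes all remaining rows agree at \<open>j\<close> and \<open>l\<close>,
      so \<open>j\<close> moves into the matched set with partner \<open>l\<close>.\<close>
    define k where "k q = (g q j - g q l) / (g q0 j - g q0 l)" for q
    define h where "h q u = g q u - k q * g q0 u" for q u
    have hj: "h q j = h q l" for q
      using jl(3) by (simp add: h_def k_def field_simps)
    let ?J = "J - {q0}" and ?S = "insert j S" and ?T = "T - {j}"
    have V: "?S \<union> ?T \<union> I = ?V" using jl(1) by auto
    have "\<exists>s'. (\<forall>j\<in>?T. s' j \<in> I) \<and>
       (\<forall>\<phi>. (\<forall>j\<in>?T. (\<Sum>q\<in>?J. \<phi> q * h q j) = (\<Sum>q\<in>?J. \<phi> q * h q (s' j)))
           \<longrightarrow> (\<forall>u\<in>?S \<union> ?T \<union> I. (\<Sum>q\<in>?J. \<phi> q * h q u) = 0))"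
    proof (rule Suc.hyps(1))
      show "m = card ?J" using Suc.hyps(2) q0(1) Suc.prems(1) by simp
      show "card ?J \<le> card ?T"
        using Suc.prems(1,3,6) q0(1) jl(1) by (simp add: card_Diff_singleton diff_le_mono)
      show "(s(j := l)) i \<in> I \<and> h q i = h q ((s(j := l)) i)" if "q \<in> ?J" "i \<in> ?S" for q i
      proof (cases "i = j")
        case True
        then show ?thesis using jl(2) hj by simp
      next
        case False
        then have "i \<in> S" using that by simp
        then show ?thesis
          using Suc.prems(7)[of q i] Suc.prems(7)[of q0 i] that(1) q0(1) False by (simp add: h_def)
      qed
      show "(\<Sum>u\<in>?S \<union> ?T \<union> I. h q u) = 0" if "q \<in> ?J" for q
        using Suc.prems(8)[of q] Suc.prems(8)[OF q0(1)] that unfolding V h_def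
        by (simp add: sum_subtractf sum_distrib_left[symmetric])
    qed (use Suc.prems in auto)
    then obtain s' where s': "\<forall>j\<in>?T. s' j \<in> I"
      "\<forall>\<phi>. (\<forall>j\<in>?T. (\<Sum>q\<in>?J. \<phi> q * h q j) = (\<Sum>q\<in>?J. \<phi> q * h q (s' j)))
           \<longrightarrow> (\<forall>u\<in>?S \<union> ?T \<union> I. (\<Sum>q\<in>?J. \<phi> q * h q u) = 0)" by (elim exE conjE)
    have "\<forall>u\<in>?V. (\<Sum>q\<in>J. \<phi> q * g q u) = 0"
      if \<phi>: "\<forall>i\<in>T. (\<Sum>q\<in>J. \<phi> q * g q i) = (\<Sum>q\<in>J. \<phi> q * g q ((s'(j := l)) i))" for \<phi>
    proof -
      have split: "(\<Sum>q\<in>J. \<phi> q * f q) = \<phi> q0 * f q0 + (\<Sum>q\<in>?J. \<phi> q * f q)" for f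
        using Suc.prems(1) q0(1) by (simp add: sum.remove)
      have "\<phi> q0 * g q0 j + (\<Sum>q\<in>?J. \<phi> q * g q j) = \<phi> q0 * g q0 l + (\<Sum>q\<in>?J. \<phi> q * g q l)"
        using \<phi>[rule_format, OF jl(1)] by (simp only: split fun_upd_same)
      \<comment> \<open>The condition at \<open>j\<close> alone determines \<open>\<phi> q0\<close>
        and turns the combination of the \<open>g q\<close> into one of the \<open>h q\<close>, to
        which the induction hypothesis applies.\<close>
      then have "\<phi> q0 * (g q0 j - g q0 l) = - (\<Sum>q\<in>?J. \<phi> q * (g q j - g q l))"
        by (simp add: right_diff_distrib sum_subtractf)
      also have "\<dots> = (- (\<Sum>q\<in>?J. \<phi> q * k q)) * (g q0 j - g q0 l)"
        using jl(3) by (simp add: k_def sum_distrib_right)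
      finally have \<phi>0: "\<phi> q0 = - (\<Sum>q\<in>?J. \<phi> q * k q)"
        using jl(3) by (metis mult_right_cancel right_minus_eq)
      have comb: "(\<Sum>q\<in>J. \<phi> q * g q u) = (\<Sum>q\<in>?J. \<phi> q * h q u)" for u
        unfolding split \<phi>0 h_def
        by (simp add: right_diff_distrib sum_subtractf sum_distrib_right mult.assoc)
      have "\<forall>i\<in>?T. (\<Sum>q\<in>?J. \<phi> q * h q i) = (\<Sum>q\<in>?J. \<phi> q * h q (s' i))"
        using \<phi> unfolding comb by auto
      then show ?thesis using s'(2) unfolding V comb by blast
    qed
    moreover have "\<forall>i\<in>T. (s'(j := l)) i \<in> I" using s'(1) jl(2) by simp
    ultimately show ?thesis by (intro exI[of _ "s'(j := l)"] conjI allI impI)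
  qed
qed

text \<open>A split graph reduced to its bipartite weights: \<open>K\<close> stands for the clique
  and \<open>I\<close> for the independent set. The iteration sees the weights only through their
  bounds 0 and 1.\<close>

locale bipartite_weights =
  fixes K I :: "'a set" and B :: "'a \<Rightarrow> 'a \<Rightarrow> real"
  assumes finK: "finite K" and finI: "finite I" and disj: "K \<inter> I = {}"
    and B01: "i \<in> K \<Longrightarrow> l \<in> I \<Longrightarrow> 0 \<le> B i l \<and> B i l \<le> 1"
begin

definition dK :: "'a \<Rightarrow> real" where "dK i = (\<Sum>l\<in>I. B i l)"
definition dI :: "'a \<Rightarrow> real" where "dI l = (\<Sum>i\<in>K. B i l)"

text \<open>The diagonal term on \<open>K\<close> has \<open>card K\<close> although the degree
  inside the clique is \<open>card K - 1\<close>, because the sum over \<open>K\<close> that is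
  subtracted includes \<open>u\<close> itself.\<close>

definition lap :: "('a \<Rightarrow> real) \<Rightarrow> 'a \<Rightarrow> real" where
  "lap f u = (if u \<in> K then (card K + dK u) * f u - (\<Sum>j\<in>K. f j) - (\<Sum>l\<in>I. B u l * f l)
     else dI u * f u - (\<Sum>i\<in>K. B i u * f i))"

text \<open>\<open>on_graph W f\<close> says that \<open>f\<close> lies in the subspace \<open>{(x, - W x)}\<close> of functions on \<open>K \<union> I\<close>;
  \<open>compr W\<close> is the matrix of \<open>lap\<close> on that subspace in the coordinates \<open>x\<close>. The column sums of \<open>W\<close>
  are 1 exactly when the subspace is orthogonal to the constants.\<close>

definition on_graph :: "('a \<Rightarrow> 'a \<Rightarrow> real) \<Rightarrow> ('a \<Rightarrow> real) \<Rightarrow> bool" where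
  "on_graph W f \<longleftrightarrow> (\<forall>l\<in>I. f l = - (\<Sum>i\<in>K. W l i * f i))"

definition stoch :: "('a \<Rightarrow> 'a \<Rightarrow> real) \<Rightarrow> bool" where
  "stoch W \<longleftrightarrow> (\<forall>l\<in>I. \<forall>i\<in>K. 0 \<le> W l i) \<and> (\<forall>i\<in>K. (\<Sum>l\<in>I. W l i) = 1)"

definition compr :: "('a \<Rightarrow> 'a \<Rightarrow> real) \<Rightarrow> 'a \<Rightarrow> 'a \<Rightarrow> real" where
  "compr W i j = (if i = j then card K + dK i else 0) - 1 + (\<Sum>l\<in>I. B i l * W l j)"

lemma dK_nonneg: "i \<in> K \<Longrightarrow> 0 \<le> dK i"
  using B01 by (auto simp: dK_def intro: sum_nonneg)

lemma stoch_weight_le: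
  assumes "stoch W" "i \<in> K" "j \<in> K"
  shows "0 \<le> (\<Sum>l\<in>I. B i l * W l j)" "(\<Sum>l\<in>I. B i l * W l j) \<le> 1"
proof -
  show "0 \<le> (\<Sum>l\<in>I. B i l * W l j)"
    using assms B01 by (intro sum_nonneg mult_nonneg_nonneg) (auto simp: stoch_def)
  have "(\<Sum>l\<in>I. B i l * W l j) \<le> (\<Sum>l\<in>I. 1 * W l j)"
    using assms B01 by (intro sum_mono mult_right_mono) (auto simp: stoch_def)
  then show "(\<Sum>l\<in>I. B i l * W l j) \<le> 1" using assms by (simp add: stoch_def)
qed

lemma lap_on_graph_K:
  assumes "on_graph W f" "i \<in> K"
  shows "lap f i = (\<Sum>j\<in>K. compr W i j * f j)"
proof -
  have "(\<Sum>j\<in>K. compr W i j * f j) = (\<Sum>j\<in>K. (if i = j then card K + dK i else 0) * f j)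
      - (\<Sum>j\<in>K. f j) + (\<Sum>j\<in>K. (\<Sum>l\<in>I. B i l * W l j) * f j)"
    by (simp add: compr_def algebra_simps sum.distrib sum_subtractf)
  also have "(\<Sum>j\<in>K. (if i = j then card K + dK i else 0) * f j) = (card K + dK i) * f i"
    by (rule sum_mult_delta(2)[OF finK assms(2)])
  also have "(\<Sum>j\<in>K. (\<Sum>l\<in>I. B i l * W l j) * f j) = (\<Sum>l\<in>I. B i l * (\<Sum>j\<in>K. W l j * f j))"
    by (simp add: sum_distrib_left sum_distrib_right mult.assoc, subst sum.swap) simp
  also have "\<dots> = - (\<Sum>l\<in>I. B i l * f l)"
    using assms(1) by (simp add: on_graph_def sum_negf)
  finally show ?thesis using assms(2) by (simp add: lap_def)
qed

lemma lap_on_graph_I: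
  assumes "on_graph W f" "l \<in> I"
  shows "lap f l = - (\<Sum>j\<in>K. (B j l + dI l * W l j) * f j)"
proof -
  have "l \<notin> K" using disj assms(2) by auto
  then show ?thesis using assms
    by (simp add: lap_def on_graph_def distrib_right sum.distrib sum_distrib_left mult.assoc)
qed

text \<open>The transpose of \<open>compr W + 1\<close> is an M-matrix.\<close>

lemma minimum_principle:
  assumes W: "stoch W" and y: "\<And>j. j \<in> K \<Longrightarrow> 0 \<le> (\<Sum>i\<in>K. y i * compr W i j) + y j" and k: "k \<in> K"
  shows "0 \<le> y k"
proof -
  \<comment> \<open>It suffices to look at an index \<open>j\<close> where \<open>y\<close> is
    minimal; \<open>N\<close> collects, up to sign, the part of column \<open>j\<close> other than
    the diagonal matrix.\<close>
  have "Min (y ` K) \<in> y ` K" using finK k by (intro Min_in) auto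
  then obtain j where j: "j \<in> K" "y j = Min (y ` K)" by auto
  have jmin: "y j \<le> y i" if "i \<in> K" for i using that finK j(2) by simp
  define N where "N i = 1 - (\<Sum>l\<in>I. B i l * W l j)" for i
  have N: "0 \<le> N i" "N i \<le> 1" if "i \<in> K" for i
    using stoch_weight_le[OF W that j(1)] by (auto simp: N_def)
  have "(\<Sum>i\<in>K. y i * compr W i j) = (\<Sum>i\<in>K. y i * (if i = j then card K + dK i else 0)) - (\<Sum>i\<in>K. y i * N i)"
    by (simp add: compr_def N_def algebra_simps sum.distrib sum_subtractf)
  also have "(\<Sum>i\<in>K. y i * (if i = j then card K + dK i else 0)) = y j * (card K + dK j)"
    by (rule sum_mult_delta(1)[OF finK j(1)])
  finally have 1: "0 \<le> y j * (card K + dK j + 1) - (\<Sum>i\<in>K. y i * N i)"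
    using y[OF j(1)] by (simp add: algebra_simps)
  have "0 \<le> y j"
  proof (rule ccontr)
    assume "\<not> 0 \<le> y j"
    then have neg: "y j < 0" by simp
    \<comment> \<open>The entries \<open>N i\<close> add up to at most \<open>card K\<close>, which
      the diagonal exceeds by \<open>dK j + 1\<close>. The shift by 1 gives the strict inequality
      even when \<open>dK j\<close> is 0.\<close>
    have "(\<Sum>i\<in>K. N i) \<le> (\<Sum>i\<in>K. 1)" using N by (intro sum_mono) auto
    then have "y j * card K \<le> y j * (\<Sum>i\<in>K. N i)" using neg by (intro mult_left_mono_neg) auto
    also have "\<dots> \<le> (\<Sum>i\<in>K. y i * N i)"
      unfolding sum_distrib_left using N jmin by (intro sum_mono mult_right_mono) auto
    finally have "0 \<le> y j * (dK j + 1)" using 1 by (simp add: algebra_simps)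
    moreover have "y j * (dK j + 1) < 0" using neg dK_nonneg[OF j(1)] by (simp add: mult_neg_pos)
    ultimately show False by simp
  qed
  then show ?thesis using jmin[OF k] by simp
qed

text \<open>The minimum principle for \<open>y\<close> and for \<open>- y\<close>. It serves both to
  invert \<open>compr W + 1\<close> and, as a uniqueness statement, to identify the column sums of
  the new weights.\<close>

lemma left_kernel_trivial:
  assumes W: "stoch W" and y: "\<And>j. j \<in> K \<Longrightarrow> (\<Sum>i\<in>K. y i * compr W i j) + y j = 0" and k: "k \<in> K"
  shows "y k = 0"
proof -
  have "0 \<le> y k" by (rule minimum_principle[OF W _ k]) (simp only: y order_refl)
  moreover have "0 \<le> - y k"
  proof (rule minimum_principle[OF W _ k])
    fix j assume "j \<in> K"
    then show "0 \<le> (\<Sum>i\<in>K. - y i * compr W i j) + - y j"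
      using y[of j] by (simp add: sum_negf)
  qed
  ultimately show ?thesis by simp
qed

text \<open>The new weights solve \<open>W' (compr W + 1) = B\<^sup>T + dI W + W\<close>, whose right-hand side is nonnegative.\<close>

lemma power_step:
  assumes W: "stoch W"
  shows "\<exists>W'. stoch W' \<and> (\<forall>f. on_graph W f \<longrightarrow> on_graph W' (\<lambda>u. lap f u + f u))"
proof -
  define T where "T i j = compr W i j + (if i = j then 1 else 0)" for i j
  have T: "(\<Sum>i\<in>K. y i * T i j) = (\<Sum>i\<in>K. y i * compr W i j) + y j" if "j \<in> K" for y j
    using sum_mult_delta(1)[OF finK that, of y "\<lambda>_. 1"] by (simp add: T_def distrib_left sum.distrib)
  have "\<forall>y. (\<forall>j\<in>K. (\<Sum>i\<in>K. T i j * y i) = 0) \<longrightarrow> (\<forall>i\<in>K. y i = 0)"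
  proof (intro allI impI ballI)
    fix y k assume y: "\<forall>j\<in>K. (\<Sum>i\<in>K. T i j * y i) = 0" and k: "k \<in> K"
    show "y k = 0"
    proof (rule left_kernel_trivial[OF W _ k])
      fix j assume "j \<in> K"
      then show "(\<Sum>i\<in>K. y i * compr W i j) + y j = 0"
        using y T[of j y] by (simp add: mult.commute[of "y _"])
    qed
  qed
  from two_sided_inverse[OF finK finK refl this]
  obtain Y where Y: "\<forall>i\<in>K. \<forall>i'\<in>K. (\<Sum>j\<in>K. T j i * Y j i') = (if i = i' then 1 else 0)"
    by (elim exE conjE)
  define R where "R l j = B j l + dI l * W l j + W l j" for l j
  define W' where "W' l i = (\<Sum>j\<in>K. Y i j * R l j)" for l i
  have W'T: "(\<Sum>i\<in>K. W' l i * T i j) = R l j" if "j \<in> K" for l j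
  proof -
    have "(\<Sum>i\<in>K. W' l i * T i j) = (\<Sum>k\<in>K. (\<Sum>i\<in>K. T i j * Y i k) * R l k)"
      by (simp add: W'_def sum_distrib_right, subst sum.swap) (simp add: algebra_simps)
    also have "\<dots> = (\<Sum>k\<in>K. if j = k then R l k else 0)"
      using Y that by (intro sum.cong) auto
    finally show ?thesis using that finK by simp
  qed
  have dI_nonneg: "0 \<le> dI l" if "l \<in> I" for l
    using that B01 by (auto simp: dI_def intro: sum_nonneg)
  have "0 \<le> W' l k" if l: "l \<in> I" and k: "k \<in> K" for l k
  proof (rule minimum_principle[OF W _ k])
    fix j assume j: "j \<in> K"
    have "0 \<le> R l j" using W l j B01 dI_nonneg[OF l] by (auto simp: R_def stoch_def)
    then show "0 \<le> (\<Sum>i\<in>K. W' l i * compr W i j) + W' l j"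
      using W'T[OF j, of l] T[OF j, of "W' l"] by simp
  qed
  \<comment> \<open>The columns of a Laplacian sum to 0, so the all-ones row vector also takes
    \<open>T\<close> to the column sums of \<open>R\<close>. Uniqueness then forces the column sums
    of \<open>W'\<close> to be 1.\<close>
  moreover have "(\<Sum>l\<in>I. W' l k) - 1 = 0" if k: "k \<in> K" for k
  proof (rule left_kernel_trivial[OF W _ k])
    fix j assume j: "j \<in> K"
    have "(\<Sum>i\<in>K. (\<Sum>l\<in>I. W' l i) * T i j) = (\<Sum>l\<in>I. R l j)"
      using W'T[OF j] by (simp add: sum_distrib_right, subst sum.swap) simp
    also have "\<dots> = dK j + (\<Sum>l\<in>I. dI l * W l j) + 1"
      using W j by (simp add: R_def sum.distrib stoch_def dK_def)
    also have "(\<Sum>l\<in>I. dI l * W l j) = (\<Sum>i\<in>K. \<Sum>l\<in>I. B i l * W l j)"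
      by (simp add: dI_def sum_distrib_right, rule sum.swap)
    also have "dK j + \<dots> + 1 = (\<Sum>i\<in>K. 1 * T i j)"
      unfolding T[OF j, of "\<lambda>_. 1"] using finK j by (simp add: compr_def sum.distrib sum_subtractf)
    finally have "(\<Sum>i\<in>K. ((\<Sum>l\<in>I. W' l i) - 1) * T i j) = 0"
      by (simp add: left_diff_distrib sum_subtractf)
    then show "(\<Sum>i\<in>K. ((\<Sum>l\<in>I. W' l i) - 1) * compr W i j) + ((\<Sum>l\<in>I. W' l j) - 1) = 0"
      using T[OF j, of "\<lambda>i. (\<Sum>l\<in>I. W' l i) - 1"] by simp
  qed
  ultimately have "stoch W'" by (simp add: stoch_def)
  \<comment> \<open>In coordinates, \<open>lap + 1\<close> sends \<open>x\<close> on
    \<open>K\<close> to \<open>T x\<close>, and its values on \<open>I\<close> become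
    \<open>- R x\<close>; the equation \<open>W' T = R\<close> places the image on the new
    graph.\<close>
  moreover have "on_graph W' (\<lambda>u. lap f u + f u)" if f: "on_graph W f" for f
    unfolding on_graph_def
  proof
    fix l assume l: "l \<in> I"
    have gK: "lap f i + f i = (\<Sum>j\<in>K. T i j * f j)" if "i \<in> K" for i
      using lap_on_graph_K[OF f that] sum_mult_delta(2)[OF finK that, of "\<lambda>_. 1" f]
      by (simp add: T_def distrib_right sum.distrib)
    have "(\<Sum>i\<in>K. W' l i * (lap f i + f i)) = (\<Sum>i\<in>K. W' l i * (\<Sum>j\<in>K. T i j * f j))"
      by (intro sum.cong refl) (simp add: gK)
    also have "\<dots> = (\<Sum>j\<in>K. (\<Sum>i\<in>K. W' l i * T i j) * f j)"
      by (simp add: sum_distrib_left sum_distrib_right mult.assoc, rule sum.swap)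
    also have "\<dots> = (\<Sum>j\<in>K. R l j * f j)"
      by (simp add: W'T)
    also have "\<dots> = (\<Sum>j\<in>K. (B j l + dI l * W l j) * f j) + (\<Sum>j\<in>K. W l j * f j)"
      by (simp add: R_def distrib_right sum.distrib)
    also have "\<dots> = - lap f l - f l"
      using lap_on_graph_I[OF f l] f l by (simp add: on_graph_def)
    finally show "lap f l + f l = - (\<Sum>i\<in>K. W' l i * (lap f i + f i))" by simp
  qed
  ultimately show ?thesis by blast
qed

end

section \<open>Limits of invariant graphs and the trace bound\<close>

context bipartite_weights
begin

abbreviation "V \<equiv> K \<union> I"

lemma lap_sum: "lap (\<lambda>u. \<Sum>j\<in>J. a j * f j u) w = (\<Sum>j\<in>J. a j * lap (f j) w)"
proof -
  have *: "(\<Sum>u\<in>S. \<Sum>j\<in>J. a j * f j u) = (\<Sum>j\<in>J. a j * (\<Sum>u\<in>S. f j u))" for S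
    by (subst sum.swap) (simp add: sum_distrib_left)
  have **: "(\<Sum>u\<in>S. b u * (\<Sum>j\<in>J. a j * f j u)) = (\<Sum>j\<in>J. a j * (\<Sum>u\<in>S. b u * f j u))" for S b
    by (simp add: sum_distrib_left, subst sum.swap) (simp add: mult.left_commute)
  have ***: "x * (\<Sum>j\<in>J. a j * f j w) = (\<Sum>j\<in>J. a j * (x * f j w))" for x
    by (simp add: sum_distrib_left mult.left_commute)
  show ?thesis
    by (simp add: lap_def * ** *** sum_subtractf[symmetric] right_diff_distrib)
qed

lemma on_graph_cong:
  assumes "\<And>u. u \<in> V \<Longrightarrow> f u = g u" "on_graph W f"
  shows "on_graph W g"
  unfolding on_graph_def
proof
  fix l assume l: "l \<in> I"
  have "g l = - (\<Sum>i\<in>K. W l i * f i)" using assms(1)[of l] assms(2) l by (simp add: on_graph_def)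
  also have "(\<Sum>i\<in>K. W l i * f i) = (\<Sum>i\<in>K. W l i * g i)"
    using assms(1) by (intro sum.cong refl) simp
  finally show "g l = - (\<Sum>i\<in>K. W l i * g i)" .
qed

lemma on_graph_scale: "c \<noteq> 0 \<Longrightarrow> on_graph W (\<lambda>u. c * f u) \<longleftrightarrow> on_graph W f"
proof -
  assume c: "c \<noteq> 0"
  have "- (\<Sum>i\<in>K. W l i * (c * f i)) = c * - (\<Sum>i\<in>K. W l i * f i)" for l
    by (simp add: sum_distrib_left mult.left_commute)
  moreover have "c * f l = c * - (\<Sum>i\<in>K. W l i * f i) \<longleftrightarrow> f l = - (\<Sum>i\<in>K. W l i * f i)" for l
    using c by (rule mult_left_cancel)
  ultimately show ?thesis by (simp only: on_graph_def)
qed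

lemma on_graph_sum:
  assumes "\<And>j. j \<in> J \<Longrightarrow> on_graph W (f j)"
  shows "on_graph W (\<lambda>u. \<Sum>j\<in>J. a j * f j u)"
  unfolding on_graph_def
proof
  fix l assume l: "l \<in> I"
  have "(\<Sum>j\<in>J. a j * f j l) = (\<Sum>j\<in>J. a j * - (\<Sum>i\<in>K. W l i * f j i))"
    using assms l by (intro sum.cong) (auto simp: on_graph_def)
  also have "\<dots> = - (\<Sum>j\<in>J. \<Sum>i\<in>K. W l i * (a j * f j i))"
    by (simp add: sum_negf sum_distrib_left mult.left_commute)
  also have "(\<Sum>j\<in>J. \<Sum>i\<in>K. W l i * (a j * f j i)) = (\<Sum>i\<in>K. W l i * (\<Sum>j\<in>J. a j * f j i))"
    by (subst sum.swap) (simp add: sum_distrib_left)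
  finally show "(\<Sum>j\<in>J. a j * f j l) = - (\<Sum>i\<in>K. W l i * (\<Sum>j\<in>J. a j * f j i))" .
qed

lemma stoch_le_1: "stoch W \<Longrightarrow> l \<in> I \<Longrightarrow> i \<in> K \<Longrightarrow> W l i \<le> 1"
  using member_le_sum[of l I "\<lambda>l. W l i"] finI by (auto simp: stoch_def)

lemma stoch_limit:
  assumes "\<And>t :: nat. stoch (W t)" "\<And>l i. l \<in> I \<Longrightarrow> i \<in> K \<Longrightarrow> (\<lambda>t. W t l i) \<longlonglongrightarrow> W' l i"
  shows "stoch W'"
  unfolding stoch_def
proof (intro conjI ballI)
  fix l i assume "l \<in> I" "i \<in> K"
  then show "0 \<le> W' l i"
    using assms by (intro LIMSEQ_le_const[of "\<lambda>t. W t l i"]) (auto simp: stoch_def)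
next
  fix i assume i: "i \<in> K"
  have "(\<lambda>t. \<Sum>l\<in>I. W t l i) \<longlonglongrightarrow> (\<Sum>l\<in>I. W' l i)"
    using assms(2) i by (intro tendsto_sum) auto
  moreover have "(\<Sum>l\<in>I. W t l i) = 1" for t using assms(1)[of t] i by (simp add: stoch_def)
  ultimately show "(\<Sum>l\<in>I. W' l i) = 1" by (simp add: LIMSEQ_const_iff)
qed

lemma on_graph_limit:
  assumes "\<And>t :: nat. on_graph (W t) (f t)" "\<And>l i. l \<in> I \<Longrightarrow> i \<in> K \<Longrightarrow> (\<lambda>t. W t l i) \<longlonglongrightarrow> W' l i"
    and "\<And>u. u \<in> V \<Longrightarrow> (\<lambda>t. f t u) \<longlonglongrightarrow> f' u"
  shows "on_graph W' f'"
  unfolding on_graph_def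
proof
  fix l assume l: "l \<in> I"
  have "(\<lambda>t. - (\<Sum>i\<in>K. W t l i * f t i)) \<longlonglongrightarrow> - (\<Sum>i\<in>K. W' l i * f' i)"
    using assms l by (intro tendsto_minus tendsto_sum tendsto_mult) auto
  moreover have "f t l = - (\<Sum>i\<in>K. W t l i * f t i)" for t
    using assms(1)[of t] l by (simp add: on_graph_def)
  then have "(\<lambda>t. - (\<Sum>i\<in>K. W t l i * f t i)) \<longlonglongrightarrow> f' l"
    using assms(3)[of l] l by simp
  ultimately show "f' l = - (\<Sum>i\<in>K. W' l i * f' i)" by (rule LIMSEQ_unique[rotated])
qed

lemma trace_compr:
  "(\<Sum>i\<in>K. compr W i i) = card K * (real (card K) - 1) + (\<Sum>i\<in>K. dK i) + (\<Sum>i\<in>K. \<Sum>l\<in>I. B i l * W l i)"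
  by (simp add: compr_def sum.distrib sum_subtractf right_diff_distrib)

text \<open>The second conclusion is the Riccati equation expressing invariance of the graph.\<close>

lemma eigenvectors_on_graph:
  assumes u: "\<forall>i<card K. on_graph W (u i)"
    and eig: "\<forall>i<card K. \<forall>w\<in>V. lap (u i) w = l i * u i w"
    and indep: "\<forall>z. (\<forall>w\<in>V. (\<Sum>i<card K. z i * u i w) = 0) \<longrightarrow> (\<forall>i<card K. z i = (0 :: real))"
  shows "(\<Sum>i<card K. l i) = (\<Sum>i\<in>K. compr W i i)"
    and "\<And>m j. m \<in> I \<Longrightarrow> j \<in> K \<Longrightarrow> B j m + dI m * W m j = (\<Sum>i\<in>K. W m i * compr W i j)"
proof -
  let ?c = "card K"
  \<comment> \<open>A function on the graph that vanishes on \<open>K\<close> vanishes everywhere,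
    so the restrictions of the \<open>u i\<close> to \<open>K\<close> form a basis. In it
    \<open>compr W\<close> is diagonal with entries \<open>l i\<close>.\<close>
  have triv: "\<forall>z. (\<forall>j\<in>K. (\<Sum>i<?c. u i j * z i) = 0) \<longrightarrow> (\<forall>i\<in>{..<?c}. z i = 0)"
  proof (intro allI impI ballI)
    fix z :: "nat \<Rightarrow> real" and i
    assume z: "\<forall>j\<in>K. (\<Sum>i<?c. u i j * z i) = 0" and i: "i \<in> {..<?c}"
    have zK: "(\<Sum>i<?c. z i * u i w) = 0" if "w \<in> K" for w
      using z that by (simp add: mult.commute)
    have "on_graph W (\<lambda>w. \<Sum>i<?c. z i * u i w)" using u by (intro on_graph_sum) auto
    then have "(\<Sum>i<?c. z i * u i w) = 0" if "w \<in> I" for w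
      using zK that by (simp add: on_graph_def)
    then show "z i = 0" using indep zK i by blast
  qed
  from two_sided_inverse[OF finK finite_lessThan card_lessThan[symmetric] triv]
  obtain Y where Y1: "\<forall>j\<in>K. \<forall>j'\<in>K. (\<Sum>i<?c. u i j * Y i j') = (if j = j' then 1 else 0)"
    and Y2: "\<forall>i\<in>{..<?c}. \<forall>i'\<in>{..<?c}. (\<Sum>j\<in>K. Y i j * u i' j) = (if i = i' then 1 else 0)"
    by (elim exE conjE)
  have A: "(\<Sum>m\<in>K. compr W k m * u i m) = l i * u i k" if "i < ?c" "k \<in> K" for i k
    using lap_on_graph_K[OF u[rule_format, OF that(1)] that(2)] eig that by simp
  have expand: "g k = (\<Sum>i<?c. (\<Sum>m\<in>K. g m * u i m) * Y i k)" if "k \<in> K" for g k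
  proof -
    have "(\<Sum>i<?c. (\<Sum>m\<in>K. g m * u i m) * Y i k) = (\<Sum>m\<in>K. g m * (\<Sum>i<?c. u i m * Y i k))"
      by (simp add: sum_distrib_left sum_distrib_right mult.assoc, subst sum.swap) simp
    also have "\<dots> = (\<Sum>m\<in>K. g m * (if m = k then 1 else 0))"
      using Y1 that by (intro sum.cong) auto
    finally show ?thesis using sum_mult_delta(1)[OF finK that, of g "\<lambda>_. 1"] by simp
  qed
  have "(\<Sum>k\<in>K. compr W k k) = (\<Sum>k\<in>K. \<Sum>i<?c. l i * (Y i k * u i k))"
  proof (intro sum.cong refl)
    fix k assume k: "k \<in> K"
    show "compr W k k = (\<Sum>i<?c. l i * (Y i k * u i k))"
      using expand[OF k, of "compr W k"] A[OF _ k] by (simp add: mult_ac)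
  qed
  also have "\<dots> = (\<Sum>i<?c. l i * (\<Sum>k\<in>K. Y i k * u i k))"
    by (subst sum.swap) (simp add: sum_distrib_left)
  also have "\<dots> = (\<Sum>i<?c. l i)" using Y2 by simp
  finally show "(\<Sum>i<?c. l i) = (\<Sum>i\<in>K. compr W i i)" by simp
  fix m j assume m: "m \<in> I" and j: "j \<in> K"
  define g where "g k = B k m + dI m * W m k - (\<Sum>i\<in>K. W m i * compr W i k)" for k
  \<comment> \<open>Both sides of the Riccati equation take the restriction of \<open>u i\<close> to
    \<open>- lap (u i) m\<close>; agreement on a basis gives equality of entries.\<close>
  have "(\<Sum>k\<in>K. g k * u i k) = 0" if i: "i < ?c" for i
  proof -
    have "(\<Sum>k\<in>K. (\<Sum>i\<in>K. W m i * compr W i k) * u i k) = (\<Sum>k\<in>K. W m k * (\<Sum>n\<in>K. compr W k n * u i n))"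
      by (simp add: sum_distrib_left sum_distrib_right mult.assoc, rule sum.swap)
    also have "\<dots> = l i * (\<Sum>k\<in>K. W m k * u i k)"
      using A[OF i] by (simp add: sum_distrib_left mult.left_commute)
    also have "\<dots> = - lap (u i) m"
      using u i m eig by (simp add: on_graph_def)
    also have "\<dots> = (\<Sum>k\<in>K. (B k m + dI m * W m k) * u i k)"
      using lap_on_graph_I[OF u[rule_format, OF i] m] by simp
    finally show ?thesis by (simp add: g_def left_diff_distrib sum_subtractf)
  qed
  then have "g j = 0" using expand[OF j, of g] by simp
  then show "B j m + dI m * W m j = (\<Sum>i\<in>K. W m i * compr W i j)" by (simp add: g_def)
qed

lemma power_ratio_limit:
  fixes a b :: real
  assumes "0 \<le> b" "b \<le> a"
  shows "(\<lambda>t. ((b + 1) / (a + 1)) ^ t) \<longlonglongrightarrow> (if b = a then 1 else 0)"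
proof (cases "b = a")
  case True
  then show ?thesis using assms by simp
next
  case False
  then have "0 \<le> (b + 1) / (a + 1)" "(b + 1) / (a + 1) < 1" using assms by (auto simp: field_simps)
  then show ?thesis using False by (simp add: LIMSEQ_realpow_zero)
qed

text \<open>Subspace iteration with \<open>lap + 1\<close>: a suitable basis of the iterated subspace converges to
  eigenvectors for the \<open>card K\<close> largest eigenvalues, and the weights converge along a subsequence
  by compactness. No spectral gap is needed.\<close>

lemma dominant_invariant_graph:
  assumes I0: "I \<noteq> {}" and o: "orthonormal_on V (card V) v"
    and eig: "\<forall>i<card V. \<forall>w\<in>V. lap (v i) w = l i * v i w"
    and anti: "\<forall>i j. i \<le> j \<longrightarrow> j < card V \<longrightarrow> l j \<le> l i"
    and nonneg: "\<forall>i<card V. 0 \<le> l i"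
    and perp: "\<forall>i<card K. (\<Sum>w\<in>V. v i w) = 0"
  shows "\<exists>W. stoch W \<and> (\<Sum>i<card K. l i) = (\<Sum>i\<in>K. compr W i i) \<and>
    (\<forall>m\<in>I. \<forall>j\<in>K. B j m + dI m * W m j = (\<Sum>i\<in>K. W m i * compr W i j))"
proof -
  let ?c = "card K" and ?n = "card V"
  have finV: "finite V" using finK finI by simp
  have cn: "?c \<le> ?n" using finV by (intro card_mono) auto
  have "\<exists>s. (\<forall>j\<in>K. s j \<in> I) \<and>
      (\<forall>\<phi>. (\<forall>j\<in>K. (\<Sum>q<?c. \<phi> q * v q j) = (\<Sum>q<?c. \<phi> q * v q (s j)))
           \<longrightarrow> (\<forall>u\<in>{} \<union> K \<union> I. (\<Sum>q<?c. \<phi> q * v q u) = 0))"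
    by (rule transversal_choice) (use finK finI I0 perp in auto)
  then obtain s where s: "\<forall>j\<in>K. s j \<in> I"
    and sker: "\<forall>\<phi>. (\<forall>j\<in>K. (\<Sum>q<?c. \<phi> q * v q j) = (\<Sum>q<?c. \<phi> q * v q (s j)))
           \<longrightarrow> (\<forall>u\<in>V. (\<Sum>q<?c. \<phi> q * v q u) = 0)" unfolding Un_empty_left by (elim exE conjE)
  have coeff0: "\<phi> i = 0" if "\<forall>u\<in>V. (\<Sum>q<?n. \<phi> q * v q u) = 0" "i < ?n" for \<phi> i
    using orthonormal_combination_coeff[OF finV o, of "{..<?n}" i \<phi>] that by simp
  have triv: "\<forall>\<phi>. (\<forall>j\<in>K. (\<Sum>q<?c. (v q j - v q (s j)) * \<phi> q) = 0) \<longrightarrow> (\<forall>q\<in>{..<?c}. \<phi> q = 0)"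
  proof (intro allI impI ballI)
    fix \<phi> :: "nat \<Rightarrow> real" and q
    assume z: "\<forall>j\<in>K. (\<Sum>q<?c. (v q j - v q (s j)) * \<phi> q) = 0" and q: "q \<in> {..<?c}"
    have "\<forall>j\<in>K. (\<Sum>q<?c. \<phi> q * v q j) = (\<Sum>q<?c. \<phi> q * v q (s j))"
      using z by (simp add: mult.commute[of _ "\<phi> _"] right_diff_distrib sum_subtractf)
    then have "\<forall>u\<in>V. (\<Sum>q<?c. \<phi> q * v q u) = 0" using sker by blast
    then show "\<phi> q = 0"
      using orthonormal_combination_coeff[OF finV o, of "{..<?c}" q \<phi>] q cn by auto
  qed
  from two_sided_inverse[OF finK finite_lessThan card_lessThan[symmetric] triv]
  obtain Y where Y: "\<forall>q\<in>{..<?c}. \<forall>q'\<in>{..<?c}. (\<Sum>j\<in>K. Y q j * (v q' j - v q' (s j))) = (if q = q' then 1 else 0)"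
    by (elim exE conjE)
  \<comment> \<open>This is the sum over \<open>j\<close> of \<open>Y i j\<close> times e_j - e_(s
    j), where e_w is the indicator of w. The inverse \<open>Y\<close> makes its coefficients along
    the first \<open>card K\<close> eigenfunctions those of the i-th one.\<close>
  define u0 where "u0 i w = (if w \<in> K then Y i w else - (\<Sum>j | j \<in> K \<and> s j = w. Y i j))" for i w
  define a where "a i j = (\<Sum>w\<in>V. u0 i w * v j w)" for i j
  \<comment> \<open>The \<open>t\<close>-th iterate of \<open>lap + 1\<close> on
    \<open>u0 i\<close>, divided by the \<open>t\<close>-th power of \<open>l i + 1\<close> and
    written in the eigenbasis.\<close>
  define u where "u t i w = (\<Sum>j<?n. (a i j * ((l j + 1) / (l i + 1)) ^ t) * v j w)" for t i w
  have a: "a i j = (if i = j then 1 else 0)" if "i < ?c" "j < ?c" for i j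
  proof -
    have "a i j = (\<Sum>w\<in>K. Y i w * v j w) + (\<Sum>w\<in>I. u0 i w * v j w)"
      unfolding a_def using finK finI disj by (simp add: sum.union_disjoint u0_def)
    also have "(\<Sum>w\<in>I. u0 i w * v j w) = - (\<Sum>w\<in>I. \<Sum>k | k \<in> K \<and> s k = w. Y i k * v j (s k))"
      unfolding sum_negf[symmetric] using disj
      by (intro sum.cong refl) (auto simp: u0_def sum_distrib_right sum_negf)
    also have "(\<Sum>w\<in>I. \<Sum>k | k \<in> K \<and> s k = w. Y i k * v j (s k)) = (\<Sum>k\<in>K. Y i k * v j (s k))"
      using s by (intro sum.group[OF finK finI]) auto
    also have "(\<Sum>w\<in>K. Y i w * v j w) + - \<dots> = (\<Sum>k\<in>K. Y i k * (v j k - v j (s k)))"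
      by (simp add: right_diff_distrib sum_subtractf)
    finally show ?thesis using Y that by simp
  qed
  have u0: "u 0 i w = u0 i w" if "w \<in> V" for i w
    using orthonormal_expansion[OF finV o that, of "u0 i"] by (simp add: u_def a_def)
  have "\<exists>W. stoch W \<and> (\<forall>i<?c. on_graph W (u t i))" for t
  proof (induction t)
    case 0
    \<comment> \<open>Each vertex of \<open>K\<close> has exactly one partner in \<open>I\<close>,
      so the initial weights are 0 or 1 with column sums 1.\<close>
    define W where "W w j = (if s j = w then 1 else 0 :: real)" for w j
    have "stoch W" using s finI by (simp add: stoch_def W_def)
    moreover have "on_graph W (u 0 i)" for i
    proof (rule on_graph_cong)
      show "u0 i w = u 0 i w" if "w \<in> V" for w using u0[OF that] by simp
      show "on_graph W (u0 i)" unfolding on_graph_def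
      proof
        fix w assume w: "w \<in> I"
        have "(\<Sum>j\<in>K. W w j * u0 i j) = (\<Sum>j\<in>K. if s j = w then Y i j else 0)"
          by (intro sum.cong) (auto simp: W_def u0_def)
        also have "\<dots> = (\<Sum>j | j \<in> K \<and> s j = w. Y i j)"
          using finK by (simp add: sum.inter_filter)
        finally show "u0 i w = - (\<Sum>j\<in>K. W w j * u0 i j)" using w disj by (auto simp: u0_def)
      qed
    qed
    ultimately show ?case by blast
  next
    case (Suc t)
    then obtain W where W: "stoch W" "\<forall>i<?c. on_graph W (u t i)" by blast
    obtain W' where W': "stoch W'" "\<forall>f. on_graph W f \<longrightarrow> on_graph W' (\<lambda>u. lap f u + f u)"
      using power_step[OF W(1)] by (elim exE conjE)
    have "on_graph W' (u (Suc t) i)" if i: "i < ?c" for i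
    proof -
      have pos: "l i + 1 \<noteq> 0" using nonneg[rule_format, of i] i cn by simp
      have step: "lap (u t i) w + u t i w = (l i + 1) * u (Suc t) i w" if w: "w \<in> V" for w
      proof -
        define q where "q j = a i j * ((l j + 1) / (l i + 1)) ^ t" for j
        have "lap (u t i) w + u t i w = (\<Sum>j<?n. q j * lap (v j) w) + (\<Sum>j<?n. q j * v j w)"
          unfolding u_def lap_sum q_def ..
        also have "\<dots> = (\<Sum>j<?n. q j * lap (v j) w + q j * v j w)"
          by (rule sum.distrib[symmetric])
        also have "\<dots> = (\<Sum>j<?n. (l i + 1) * ((a i j * ((l j + 1) / (l i + 1)) ^ Suc t) * v j w))"
        proof (intro sum.cong refl)
          fix j assume "j \<in> {..<?n}"
          then have e: "lap (v j) w = l j * v j w" using eig w by simp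
          have "(l i + 1) * ((a i j * ((l j + 1) / (l i + 1)) ^ Suc t) * v j w)
              = ((l i + 1) * ((l j + 1) / (l i + 1))) * (q j * v j w)"
            unfolding q_def power_Suc by (simp only: mult_ac)
          also have "\<dots> = (l j + 1) * (q j * v j w)" using pos by simp
          also have "\<dots> = q j * lap (v j) w + q j * v j w" unfolding e by (simp add: algebra_simps)
          finally show "q j * lap (v j) w + q j * v j w
            = (l i + 1) * ((a i j * ((l j + 1) / (l i + 1)) ^ Suc t) * v j w)" by (rule sym)
        qed
        finally show ?thesis by (simp only: u_def sum_distrib_left)
      qed
      have "on_graph W' (\<lambda>w. lap (u t i) w + u t i w)" using W(2) W'(2) i by blast
      then have "on_graph W' (\<lambda>w. (l i + 1) * u (Suc t) i w)"
        by (rule on_graph_cong[rotated]) (rule step)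
      then show ?thesis using on_graph_scale[OF pos] by simp
    qed
    then show ?case using W'(1) by blast
  qed
  then obtain W where W: "\<And>t. stoch (W t)" "\<And>t i. i < ?c \<Longrightarrow> on_graph (W t) (u t i)"
    by metis
  have bd: "\<bar>W t (fst p) (snd p)\<bar> \<le> 1" if "p \<in> I \<times> K" for t p
    using W(1)[of t] stoch_le_1[OF W(1)[of t], of "fst p" "snd p"] that by (auto simp: stoch_def)
  obtain r W1 where r: "strict_mono (r :: nat \<Rightarrow> nat)"
    "\<forall>p\<in>I \<times> K. (\<lambda>t. W (r t) (fst p) (snd p)) \<longlonglongrightarrow> W1 p"
    using pointwise_convergent_subsequence[of "I \<times> K" "\<lambda>t p. W t (fst p) (snd p)"] bd finI finK by blast
  define Wl where "Wl m j = W1 (m, j)" for m j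
  have Wlim: "(\<lambda>t. W (r t) m j) \<longlonglongrightarrow> Wl m j" if "m \<in> I" "j \<in> K" for m j
    using r(2)[rule_format, of "(m, j)"] that by (simp add: Wl_def)
  have stW: "stoch Wl" by (rule stoch_limit[of "\<lambda>t. W (r t)"]) (use W(1) Wlim in auto)
  define b where "b i j = (if l j = l i then a i j else 0)" for i j
  define ul where "ul i w = (\<Sum>j<?n. b i j * v j w)" for i w
  \<comment> \<open>Components with \<open>j < i\<close> could grow, but they are absent by the
    choice of \<open>u0\<close>. For \<open>j \<ge> i\<close> the ratio is at most 1, and components
    with the same eigenvalue survive, possibly beyond index \<open>card K\<close>; this is harmless
    because they stay in the eigenspace.\<close>
  have lim_b: "(\<lambda>t. a i j * ((l j + 1) / (l i + 1)) ^ t) \<longlonglongrightarrow> b i j" if i: "i < ?c" and j: "j < ?n" for i j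
  proof (cases "j < i")
    case True
    then have "a i j = 0" using a[of i j] i by simp
    then show ?thesis by (simp add: b_def)
  next
    case False
    then have "(\<lambda>t. ((l j + 1) / (l i + 1)) ^ t) \<longlonglongrightarrow> (if l j = l i then 1 else 0)"
      using i j nonneg anti by (intro power_ratio_limit) simp_all
    from tendsto_mult_left[OF this, of "a i j"] show ?thesis by (simp add: b_def if_distrib cong: if_cong)
  qed
  have lim_u: "(\<lambda>t. u (r t) i w) \<longlonglongrightarrow> ul i w" if "i < ?c" for i w
    unfolding u_def ul_def using LIMSEQ_subseq_LIMSEQ[OF lim_b[OF that] r(1)]
    by (intro tendsto_sum tendsto_mult tendsto_const) (auto simp: o_def)
  have ul_graph: "\<forall>i<?c. on_graph Wl (ul i)"
  proof (intro allI impI)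
    fix i assume i: "i < ?c"
    show "on_graph Wl (ul i)"
      by (rule on_graph_limit[of "\<lambda>t. W (r t)" "\<lambda>t. u (r t) i"]) (use W(2) Wlim lim_u i in auto)
  qed
  have ul_eig: "\<forall>i<?c. \<forall>w\<in>V. lap (ul i) w = l i * ul i w"
  proof (intro allI impI ballI)
    fix i w assume w: "w \<in> V"
    have "lap (ul i) w = (\<Sum>j<?n. b i j * (l j * v j w))"
      unfolding ul_def lap_sum using eig w by simp
    also have "\<dots> = (\<Sum>j<?n. l i * (b i j * v j w))"
      by (intro sum.cong) (auto simp: b_def)
    finally show "lap (ul i) w = l i * ul i w" by (simp add: ul_def sum_distrib_left)
  qed
  have indep: "\<forall>z. (\<forall>w\<in>V. (\<Sum>i<?c. z i * ul i w) = 0) \<longrightarrow> (\<forall>i<?c. z i = 0)"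
  proof (intro allI impI)
    fix z :: "nat \<Rightarrow> real" and k assume z: "\<forall>w\<in>V. (\<Sum>i<?c. z i * ul i w) = 0" and k: "k < ?c"
    have "(\<Sum>i<?c. z i * ul i w) = (\<Sum>j<?n. (\<Sum>i<?c. z i * b i j) * v j w)" for w
      by (simp add: ul_def sum_distrib_left sum_distrib_right mult.assoc, rule sum.swap)
    then have "\<forall>w\<in>V. (\<Sum>j<?n. (\<Sum>i<?c. z i * b i j) * v j w) = 0" using z by simp
    then have "(\<Sum>i<?c. z i * b i k) = 0" by (rule coeff0) (use k cn in simp)
    also have "(\<Sum>i<?c. z i * b i k) = (\<Sum>i<?c. z i * (if i = k then 1 else 0))"
      using a k by (intro sum.cong) (auto simp: b_def)
    finally show "z k = 0" using sum_mult_delta(1)[of "{..<?c}" k z "\<lambda>_. 1"] k by simp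
  qed
  show ?thesis
  proof (intro exI conjI ballI)
    show "stoch Wl" by (rule stW)
    show "(\<Sum>i<?c. l i) = (\<Sum>i\<in>K. compr Wl i i)"
      by (rule eigenvectors_on_graph(1)[OF ul_graph ul_eig indep])
    show "B j m + dI m * Wl m j = (\<Sum>i\<in>K. Wl m i * compr Wl i j)" if "m \<in> I" "j \<in> K" for m j
      using eigenvectors_on_graph(2)[OF ul_graph ul_eig indep that] by simp
  qed
qed

text \<open>Equality in the trace bound forces the support of \<open>W\<close> to coincide with that of \<open>B\<close>.\<close>

lemma top_eigenvalue_sum_le:
  assumes I0: "I \<noteq> {}" and o: "orthonormal_on V (card V) v"
    and eig: "\<forall>i<card V. \<forall>w\<in>V. lap (v i) w = l i * v i w"
    and anti: "\<forall>i j. i \<le> j \<longrightarrow> j < card V \<longrightarrow> l j \<le> l i"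
    and nonneg: "\<forall>i<card V. 0 \<le> l i"
    and perp: "\<forall>i<card K. (\<Sum>w\<in>V. v i w) = 0"
    and B01: "\<And>i m. i \<in> K \<Longrightarrow> m \<in> I \<Longrightarrow> B i m = 0 \<or> B i m = 1"
  shows "(\<Sum>i<card K. l i) \<le> (card K)\<^sup>2 + (\<Sum>i\<in>K. dK i)"
    and "(\<Sum>i<card K. l i) = (card K)\<^sup>2 + (\<Sum>i\<in>K. dK i) \<Longrightarrow>
      (\<forall>i\<in>K. \<exists>m\<in>I. B i m = 1) \<and>
      \<not> (\<exists>i\<in>K. \<exists>i'\<in>K. \<exists>m\<in>I. \<exists>m'\<in>I. B i m = 1 \<and> B i' m' = 1 \<and> B i m' = 0 \<and> B i' m = 0)"
proof -
  from dominant_invariant_graph[OF I0 o eig anti nonneg perp]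
  obtain W where W: "stoch W" and tr: "(\<Sum>i<card K. l i) = (\<Sum>i\<in>K. compr W i i)"
    and ric: "\<forall>m\<in>I. \<forall>j\<in>K. B j m + dI m * W m j = (\<Sum>i\<in>K. W m i * compr W i j)"
    by (elim exE conjE)
  define \<sigma> where "\<sigma> i j = (\<Sum>m\<in>I. B i m * W m j)" for i j
  have \<sigma>: "0 \<le> \<sigma> i j" "\<sigma> i j \<le> 1" if "i \<in> K" "j \<in> K" for i j
    using stoch_weight_le[OF W that] by (auto simp: \<sigma>_def)
  \<comment> \<open>The sum of the \<open>1 - \<sigma> i i\<close> is the exact defect in the bound,
    so equality forces every diagonal entry of \<open>B W\<close> to be 1.\<close>
  have tr': "(\<Sum>i<card K. l i) = (card K)\<^sup>2 + (\<Sum>i\<in>K. dK i) - (\<Sum>i\<in>K. 1 - \<sigma> i i)"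
    unfolding tr trace_compr by (simp add: \<sigma>_def sum_subtractf power2_eq_square algebra_simps)
  have defect: "0 \<le> (\<Sum>i\<in>K. 1 - \<sigma> i i)" using \<sigma> by (intro sum_nonneg) auto
  show "(\<Sum>i<card K. l i) \<le> (card K)\<^sup>2 + (\<Sum>i\<in>K. dK i)" using tr' defect by linarith
  assume "(\<Sum>i<card K. l i) = (card K)\<^sup>2 + (\<Sum>i\<in>K. dK i)"
  then have "(\<Sum>i\<in>K. 1 - \<sigma> i i) = 0" using tr' by linarith
  then have \<sigma>1: "\<sigma> i i = 1" if "i \<in> K" for i
    using sum_nonneg_eq_0_iff[of K "\<lambda>i. 1 - \<sigma> i i"] finK \<sigma> that by auto
  \<comment> \<open>The Riccati equation rearranged so that every term is nonnegative; a vanishing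
    left side kills each term on the right.\<close>
  have ric': "W m j * (card K + dK j) = B j m + dI m * W m j + (\<Sum>i\<in>K. W m i * (1 - \<sigma> i j))"
    if "m \<in> I" "j \<in> K" for m j
  proof -
    have "(\<Sum>i\<in>K. W m i * compr W i j) = (\<Sum>i\<in>K. W m i * (if i = j then card K + dK i else 0))
        - (\<Sum>i\<in>K. W m i * (1 - \<sigma> i j))"
      by (simp add: compr_def \<sigma>_def sum_subtractf[symmetric] algebra_simps sum.distrib[symmetric])
    also have "(\<Sum>i\<in>K. W m i * (if i = j then card K + dK i else 0)) = W m j * (card K + dK j)"
      by (rule sum_mult_delta(1)[OF finK that(2)])
    finally show ?thesis using ric that by simp
  qed
  have Wnn: "0 \<le> W m i" if "m \<in> I" "i \<in> K" for m i using W that by (simp add: stoch_def)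
  \<comment> \<open>If \<open>\<sigma> i j\<close> is 1, all the mass of column \<open>j\<close> of
    \<open>W\<close> sits on neighbours of \<open>i\<close>.\<close>
  have supp: "W m j = 0" if ij: "m \<in> I" "i \<in> K" "j \<in> K" "\<sigma> i j = 1" "B i m = 0" for m i j
  proof -
    have "(\<Sum>m\<in>I. (1 - B i m) * W m j) = (\<Sum>m\<in>I. W m j) - \<sigma> i j"
      by (simp add: \<sigma>_def left_diff_distrib sum_subtractf)
    also have "\<dots> = 0" using W ij by (simp add: stoch_def)
    finally have "(1 - B i m) * W m j = 0"
      using sum_nonneg_eq_0_iff[of I "\<lambda>m. (1 - B i m) * W m j"] finI ij B01 Wnn by fastforce
    then show ?thesis using ij by simp
  qed
  have term_nn: "0 \<le> W m i * (1 - \<sigma> i j)" if "m \<in> I" "i \<in> K" "j \<in> K" for m i j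
    using Wnn \<sigma> that by simp
  have pos: "W m j \<noteq> 0" if "m \<in> I" "j \<in> K" "B j m = 1" for m j
    using ric'[OF that(1,2)] that(3) sum_nonneg[OF term_nn[OF that(1) _ that(2)], of K "\<lambda>i. i"] by auto
  show "(\<forall>i\<in>K. \<exists>m\<in>I. B i m = 1) \<and>
      \<not> (\<exists>i\<in>K. \<exists>i'\<in>K. \<exists>m\<in>I. \<exists>m'\<in>I. B i m = 1 \<and> B i' m' = 1 \<and> B i m' = 0 \<and> B i' m = 0)"
  proof (intro conjI ballI notI)
    fix i assume i: "i \<in> K"
    show "\<exists>m\<in>I. B i m = 1"
    proof (rule ccontr)
      assume "\<not> ?thesis"
      then have "\<sigma> i i = 0" using B01[OF i] unfolding \<sigma>_def by (intro sum.neutral) auto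
      then show False using \<sigma>1[OF i] by simp
    qed
  next
    assume "\<exists>i\<in>K. \<exists>i'\<in>K. \<exists>m\<in>I. \<exists>m'\<in>I. B i m = 1 \<and> B i' m' = 1 \<and> B i m' = 0 \<and> B i' m = 0"
    then obtain i i' m m' where mem: "i \<in> K" "i' \<in> K" "m \<in> I" "m' \<in> I"
      and B: "B i m = 1" "B i' m' = 1" "B i m' = 0" "B i' m = 0" by blast
    \<comment> \<open>Since \<open>m'\<close> is not adjacent to \<open>i\<close>, the rearranged
      Riccati equation at \<open>m'\<close>, \<open>i\<close> has only zero terms. The weight
      \<open>W m' i'\<close> is positive, so \<open>\<sigma> i' i = 1\<close>. Column
      \<open>i\<close> is then supported on neighbours of \<open>i'\<close>, which excludes
      \<open>m\<close>, against positivity of \<open>W m i\<close>.\<close>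
    have "W m' i = 0" using supp[OF mem(4,1,1) \<sigma>1[OF mem(1)] B(3)] .
    then have "(\<Sum>k\<in>K. W m' k * (1 - \<sigma> k i)) = 0" using ric'[OF mem(4,1)] B(3) by simp
    then have "W m' i' * (1 - \<sigma> i' i) = 0"
      using sum_nonneg_eq_0_iff[of K "\<lambda>k. W m' k * (1 - \<sigma> k i)"] finK term_nn[OF mem(4) _ mem(1)] mem(2) by auto
    then have "\<sigma> i' i = 1" using pos[OF mem(4,2) B(2)] by simp
    then have "W m i = 0" using supp[OF mem(3,2,1) _ B(4)] by simp
    then show False using pos[OF mem(3,1) B(1)] by simp
  qed
qed

end

subsection \<open>Laplacian eigensystems of graphs\<close>

text \<open>The difference form makes constants visibly harmonic and passes easily to complements;
  \<open>lap_entry\<close> is the matrix form needed for diagonalisation.\<close>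

definition graph_lap :: "'a set \<Rightarrow> 'a set set \<Rightarrow> ('a \<Rightarrow> real) \<Rightarrow> 'a \<Rightarrow> real" where
  "graph_lap V E f u = (\<Sum>w\<in>V. if {u, w} \<in> E then f u - f w else 0)"

definition lap_entry :: "'a set set \<Rightarrow> 'a \<Rightarrow> 'a \<Rightarrow> real" where
  "lap_entry E u w = (if u = w then real (degree_of E u) else 0) - (if {u, w} \<in> E then 1 else 0)"

text \<open>Fixing the last vector as the normalised constant makes all earlier ones orthogonal to
  constants, which is what both the graph construction and the passage to complements
  require.\<close>

definition eigensystem :: "'a set \<Rightarrow> 'a set set \<Rightarrow> (nat \<Rightarrow> 'a \<Rightarrow> real) \<Rightarrow> (nat \<Rightarrow> real) \<Rightarrow> bool" where
  "eigensystem V E v l \<longleftrightarrow> orthonormal_on V (card V) v \<and>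
     (\<forall>i<card V. \<forall>u\<in>V. graph_lap V E (v i) u = l i * v i u) \<and>
     (\<forall>i j. i \<le> j \<longrightarrow> j < card V \<longrightarrow> l j \<le> l i) \<and>
     (\<forall>u\<in>V. v (card V - 1) u = 1 / sqrt (card V))"

lemma simple_graph_edgeE:
  assumes "simple_graph V E" "e \<in> E"
  obtains u w where "e = {u, w}" "u \<noteq> w" "u \<in> V" "w \<in> V"
proof -
  have e: "e \<subseteq> V" "card e = 2" using assms by (auto simp: simple_graph_def)
  then obtain u w where "e = {u, w}" "u \<noteq> w" unfolding card_2_iff by blast
  then show thesis using e(1) that by blast
qed

lemma simple_graph_edgeD:
  assumes "simple_graph V E" "{u, w} \<in> E"
  shows "u \<noteq> w" "u \<in> V" "w \<in> V"
proof -
  have "{u, w} \<subseteq> V" "card {u, w} = 2" using assms by (auto simp: simple_graph_def)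
  then show "u \<noteq> w" "u \<in> V" "w \<in> V" by auto
qed

lemma finite_edges: "simple_graph V E \<Longrightarrow> finite E"
  by (rule finite_subset[of E "Pow V"]) (auto simp: simple_graph_def)

lemma degree_of_eq:
  assumes "simple_graph V E"
  shows "degree_of E u = card {w \<in> V. {u, w} \<in> E}"
proof -
  have "bij_betw (\<lambda>w. {u, w}) {w \<in> V. {u, w} \<in> E} {e \<in> E. u \<in> e}"
    unfolding bij_betw_def
  proof
    show "inj_on (\<lambda>w. {u, w}) {w \<in> V. {u, w} \<in> E}"
      by (auto simp: inj_on_def doubleton_eq_iff)
    show "(\<lambda>w. {u, w}) ` {w \<in> V. {u, w} \<in> E} = {e \<in> E. u \<in> e}"
    proof
      show "{e \<in> E. u \<in> e} \<subseteq> (\<lambda>w. {u, w}) ` {w \<in> V. {u, w} \<in> E}"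
      proof
        fix e assume e: "e \<in> {e \<in> E. u \<in> e}"
        then obtain a b where ab: "e = {a, b}" "a \<in> V" "b \<in> V"
          using simple_graph_edgeE[OF assms, of e] by blast
        then show "e \<in> (\<lambda>w. {u, w}) ` {w \<in> V. {u, w} \<in> E}"
          using e by (cases "u = a") (auto simp: insert_commute)
      qed
    qed auto
  qed
  then show ?thesis unfolding degree_of_def by (rule bij_betw_same_card[symmetric])
qed

lemma real_degree_of:
  assumes "simple_graph V E"
  shows "real (degree_of E u) = (\<Sum>w\<in>V. if {u, w} \<in> E then 1 else 0)"
proof -
  have "finite V" using assms by (simp add: simple_graph_def)
  then show ?thesis unfolding degree_of_eq[OF assms] by (simp add: sum.If_cases Int_def)
qed

lemma handshake:
  assumes "simple_graph V E"
  shows "(\<Sum>u\<in>V. degree_of E u) = 2 * card E"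
proof -
  have fin: "finite V" "finite E" using assms finite_edges by (auto simp: simple_graph_def)
  have "(\<Sum>u\<in>V. degree_of E u) = (\<Sum>u\<in>V. \<Sum>e\<in>E. if u \<in> e then 1 else 0)"
    using fin by (simp add: degree_of_def sum.If_cases Int_def)
  also have "\<dots> = (\<Sum>e\<in>E. \<Sum>u\<in>V. if u \<in> e then 1 else 0)" by (rule sum.swap)
  also have "\<dots> = (\<Sum>e\<in>E. 2)"
  proof (intro sum.cong refl)
    fix e assume "e \<in> E"
    then have "e \<subseteq> V" "card e = 2" using assms by (auto simp: simple_graph_def)
    then have "V \<inter> {u. u \<in> e} = e" "card e = 2" by auto
    then show "(\<Sum>u\<in>V. if u \<in> e then 1 else 0 :: nat) = 2" using fin by (simp add: sum.If_cases)
  qed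
  finally show ?thesis by simp
qed

lemma graph_lap_eq_mat_app:
  assumes g: "simple_graph V E" and u: "u \<in> V"
  shows "graph_lap V E f u = mat_app V (lap_entry E) f u"
proof -
  have fin: "finite V" using g by (simp add: simple_graph_def)
  have "mat_app V (lap_entry E) f u = (\<Sum>w\<in>V. (if u = w then real (degree_of E u) else 0) * f w)
      - (\<Sum>w\<in>V. (if {u, w} \<in> E then 1 else 0) * f w)"
    by (simp add: mat_app_def lap_entry_def left_diff_distrib sum_subtractf)
  also have "(\<Sum>w\<in>V. (if u = w then real (degree_of E u) else 0) * f w) = real (degree_of E u) * f u"
    by (rule sum_mult_delta(2)[OF fin u])
  also have "\<dots> = (\<Sum>w\<in>V. (if {u, w} \<in> E then 1 else 0) * f u)"
    unfolding real_degree_of[OF g] by (rule sum_distrib_right)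
  finally show ?thesis unfolding graph_lap_def sum_subtractf[symmetric]
    by (simp only:) (intro sum.cong refl, simp)
qed

lemma lap_entry_sym: "lap_entry E u w = lap_entry E w u"
  by (simp add: lap_entry_def insert_commute)

text \<open>Exchanging the two ends of each edge and averaging turns the form into half the sum of
  (f u - f w)^2 over ordered adjacent pairs.\<close>

lemma ip_graph_lap_nonneg: "0 \<le> ip V f (graph_lap V E f)"
proof -
  define q where "q u w = (if {u, w} \<in> E then f u - f w else 0)" for u w
  have anti: "q u w = - q w u" for u w by (simp add: q_def insert_commute)
  have "ip V f (graph_lap V E f) = (\<Sum>u\<in>V. \<Sum>w\<in>V. f u * q u w)"
    by (simp add: ip_def graph_lap_def q_def sum_distrib_left)
  moreover have "(\<Sum>u\<in>V. \<Sum>w\<in>V. f u * q u w) = (\<Sum>u\<in>V. \<Sum>w\<in>V. - (f w * q u w))"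
  proof -
    have "(\<Sum>u\<in>V. \<Sum>w\<in>V. f u * q u w) = (\<Sum>w\<in>V. \<Sum>u\<in>V. f u * q u w)" by (rule sum.swap)
    also have "\<dots> = (\<Sum>w\<in>V. \<Sum>u\<in>V. - (f u * q w u))" by (intro sum.cong refl) (subst anti, simp)
    finally show ?thesis .
  qed
  ultimately have "2 * ip V f (graph_lap V E f) = (\<Sum>u\<in>V. \<Sum>w\<in>V. f u * q u w) + (\<Sum>u\<in>V. \<Sum>w\<in>V. - (f w * q u w))"
    by simp
  also have "\<dots> = (\<Sum>u\<in>V. \<Sum>w\<in>V. (f u - f w) * q u w)"
    by (simp only: sum.distrib[symmetric]) (simp add: left_diff_distrib)
  also have "\<dots> \<ge> 0" by (intro sum_nonneg) (simp add: q_def)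
  finally show ?thesis by simp
qed

lemma eigensystem_exists:
  assumes g: "simple_graph V E" and V: "V \<noteq> {}"
  shows "\<exists>v l. eigensystem V E v l"
proof -
  have fin: "finite V" using g by (simp add: simple_graph_def)
  define h :: "'a \<Rightarrow> real" where "h = (\<lambda>_. 1 / sqrt (card V))"
  have psd: "0 \<le> ip V f (mat_app V (lap_entry E) f)" for f
  proof -
    have "ip V f (mat_app V (lap_entry E) f) = ip V f (graph_lap V E f)"
      by (rule ip_cong) (simp_all add: graph_lap_eq_mat_app[OF g])
    then show ?thesis using ip_graph_lap_nonneg by simp
  qed
  have hh: "ip V h h = 1" using V fin by (simp add: ip_def h_def)
  have Lh: "mat_app V (lap_entry E) h u = 0" if "u \<in> V" for u
  proof -
    have "graph_lap V E h u = 0" unfolding graph_lap_def by (intro sum.neutral) (simp add: h_def)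
    then show ?thesis using graph_lap_eq_mat_app[OF g that, of h] by simp
  qed
  have sym: "\<forall>u\<in>V. \<forall>w\<in>V. lap_entry E u w = lap_entry E w u" by (simp add: lap_entry_sym)
  obtain v l where "orthonormal_on V (card V) v"
    "\<forall>i<card V. \<forall>u\<in>V. mat_app V (lap_entry E) (v i) u = l i * v i u"
    "\<forall>i j. i \<le> j \<longrightarrow> j < card V \<longrightarrow> l j \<le> l i" "v (card V - 1) = h"
    using spectral_theorem_with_kernel_vector[OF fin sym psd hh Lh] by blast
  then have "eigensystem V E v l"
    unfolding eigensystem_def using graph_lap_eq_mat_app[OF g] by (simp add: h_def)
  then show ?thesis by blast
qed

lemma eigensystemD:
  assumes "eigensystem V E v l"
  shows "orthonormal_on V (card V) v"
    "i < card V \<Longrightarrow> u \<in> V \<Longrightarrow> graph_lap V E (v i) u = l i * v i u"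
    "i \<le> j \<Longrightarrow> j < card V \<Longrightarrow> l j \<le> l i"
    "u \<in> V \<Longrightarrow> v (card V - 1) u = 1 / sqrt (card V)"
proof -
  note * = assms[unfolded eigensystem_def]
  show "orthonormal_on V (card V) v" by (rule *[THEN conjunct1])
  show "graph_lap V E (v i) u = l i * v i u" if "i < card V" "u \<in> V"
    by (rule *[THEN conjunct2, THEN conjunct1, rule_format, OF that])
  show "l j \<le> l i" if "i \<le> j" "j < card V"
    by (rule *[THEN conjunct2, THEN conjunct2, THEN conjunct1, rule_format, OF that])
  show "v (card V - 1) u = 1 / sqrt (card V)" if "u \<in> V"
    by (rule *[THEN conjunct2, THEN conjunct2, THEN conjunct2, rule_format, OF that])
qed

lemma eigensystem_eigenvalue:
  assumes "eigensystem V E v l" "i < card V"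
  shows "l i = ip V (v i) (graph_lap V E (v i))"
proof -
  have "ip V (v i) (graph_lap V E (v i)) = ip V (v i) (\<lambda>u. l i * v i u)"
    by (rule ip_cong) (simp_all add: eigensystemD(2)[OF assms])
  then show ?thesis
    using eigensystemD(1)[OF assms(1)] assms(2) by (simp add: ip_scale_right orthonormal_on_ip)
qed

lemma eigensystem_nonneg: "eigensystem V E v l \<Longrightarrow> i < card V \<Longrightarrow> 0 \<le> l i"
  by (simp only: eigensystem_eigenvalue ip_graph_lap_nonneg)

lemma eigensystem_perp:
  assumes es: "eigensystem V E v l" and i: "i < card V - 1"
  shows "(\<Sum>u\<in>V. v i u) = 0"
proof -
  have n: "0 < card V" using i by simp
  have "ip V (v i) (v (card V - 1)) = 0"
    using eigensystemD(1)[OF es] i by (simp add: orthonormal_on_ip)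
  also have "ip V (v i) (v (card V - 1)) = (\<Sum>u\<in>V. v i u * (1 / sqrt (card V)))"
    unfolding ip_def by (intro sum.cong refl) (simp only: eigensystemD(4)[OF es])
  also have "\<dots> = (\<Sum>u\<in>V. v i u) * (1 / sqrt (card V))" by (rule sum_distrib_right[symmetric])
  finally show ?thesis using n by simp
qed

lemma eigensystem_last:
  assumes es: "eigensystem V E v l" and V: "finite V" "V \<noteq> {}"
  shows "l (card V - 1) = 0"
proof -
  obtain u where u: "u \<in> V" using V by blast
  have n: "card V - 1 < card V" using V by (simp add: card_gt_0_iff)
  have "graph_lap V E (v (card V - 1)) u = 0"
    unfolding graph_lap_def using eigensystemD(4)[OF es] u by (intro sum.neutral) simp
  then have "l (card V - 1) * v (card V - 1) u = 0" using eigensystemD(2)[OF es n u] by simp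
  then show ?thesis using eigensystemD(4)[OF es u] V by simp
qed

lemma eigensystem_trace:
  assumes g: "simple_graph V E" and es: "eigensystem V E v l"
  shows "(\<Sum>i<card V. l i) = 2 * card E"
proof -
  have fin: "finite V" using g by (simp add: simple_graph_def)
  have "(\<Sum>i<card V. l i) = (\<Sum>i<card V. ip V (v i) (mat_app V (lap_entry E) (v i)))"
  proof (intro sum.cong refl)
    fix i assume "i \<in> {..<card V}"
    then have "l i = ip V (v i) (graph_lap V E (v i))" using eigensystem_eigenvalue[OF es] by simp
    also have "\<dots> = ip V (v i) (mat_app V (lap_entry E) (v i))"
      by (rule ip_cong) (simp_all add: graph_lap_eq_mat_app[OF g])
    finally show "l i = ip V (v i) (mat_app V (lap_entry E) (v i))" .
  qed
  also have "\<dots> = (\<Sum>i<card V. \<Sum>u\<in>V. \<Sum>w\<in>V. lap_entry E u w * (v i u * v i w))"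
    unfolding ip_def mat_app_def sum_distrib_left by (intro sum.cong refl) simp
  also have "\<dots> = (\<Sum>u\<in>V. \<Sum>i<card V. \<Sum>w\<in>V. lap_entry E u w * (v i u * v i w))"
    by (rule sum.swap)
  also have "\<dots> = (\<Sum>u\<in>V. \<Sum>w\<in>V. \<Sum>i<card V. lap_entry E u w * (v i u * v i w))"
    by (intro sum.cong refl sum.swap)
  also have "\<dots> = (\<Sum>u\<in>V. \<Sum>w\<in>V. lap_entry E u w * (if w = u then 1 else 0))"
    unfolding sum_distrib_left[symmetric]
    by (intro sum.cong refl) (auto simp: orthonormal_complete[OF fin eigensystemD(1)[OF es]])
  also have "\<dots> = (\<Sum>u\<in>V. lap_entry E u u)"
    using sum_mult_delta(1)[OF fin, of _ _ "\<lambda>_. 1"] by (intro sum.cong refl) simp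
  also have "\<dots> = (\<Sum>u\<in>V. real (degree_of E u))"
  proof (intro sum.cong refl)
    fix u
    have "{u, u} \<notin> E" using simple_graph_edgeD(1)[OF g, of u u] by blast
    then show "lap_entry E u u = real (degree_of E u)" by (simp add: lap_entry_def)
  qed
  also have "\<dots> = 2 * card E" using handshake[OF g] by (metis of_nat_sum)
  finally show ?thesis .
qed

text \<open>Being valid for every eigensystem, it allows the upper bound to use an abstract
  eigenbasis and the converse the explicit one of a threshold graph.\<close>

lemma laplacian_sum_eigensystem:
  assumes g: "simple_graph V E" and vs: "distinct vs" "set vs = V" and es: "eigensystem V E v l"
    and k: "k \<le> card V"
  shows "laplacian_sum vs E k = (\<Sum>i<k. l i)"
proof -
  have n: "card V = length vs" using vs distinct_card by metis
  have "laplacian_matrix vs E = mat (length vs) (length vs) (\<lambda>(a, b). lap_entry E (vs ! a) (vs ! b))"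
    by (rule eq_matI)
      (auto simp: laplacian_matrix_def degree_matrix_def adjacency_matrix_def lap_entry_def
        nth_eq_iff_index_eq[OF vs(1)])
  also have "eigenvalues_desc \<dots> = map l [0..<length vs]"
  proof (rule eigenvalues_desc_eigenbasis[OF vs refl])
    show "orthonormal_on V (length vs) v" using eigensystemD(1)[OF es] by (simp add: n)
    show "mat_app V (lap_entry E) (v i) u = l i * v i u" if "i < length vs" "u \<in> V" for i u
      using eigensystemD(2)[OF es] graph_lap_eq_mat_app[OF g that(2)] that n by metis
    show "l j \<le> l i" if "i \<le> j" "j < length vs" for i j
      using eigensystemD(3)[OF es] that n by metis
  qed
  finally have ev: "eigenvalues_desc (laplacian_matrix vs E) = map l [0..<length vs]" .
  have "laplacian_sum vs E k = (\<Sum>i<k. laplacian_eigenvalue vs E (Suc i))"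
    unfolding laplacian_sum_def One_nat_def by (rule sum.atLeast1_atMost_eq)
  also have "\<dots> = (\<Sum>i<k. l i)"
    using k n by (intro sum.cong refl) (simp add: laplacian_eigenvalue_def ev)
  finally show ?thesis .
qed

section \<open>Complement graphs\<close>

definition compl_edges :: "'a set \<Rightarrow> 'a set set \<Rightarrow> 'a set set" where
  "compl_edges V E = {e. e \<subseteq> V \<and> card e = 2} - E"

lemma simple_graph_compl: "finite V \<Longrightarrow> simple_graph V (compl_edges V E)"
  by (auto simp: simple_graph_def compl_edges_def)

lemma compl_edges_iff: "u \<in> V \<Longrightarrow> w \<in> V \<Longrightarrow> {u, w} \<in> compl_edges V E \<longleftrightarrow> u \<noteq> w \<and> {u, w} \<notin> E"
  by (auto simp: compl_edges_def card_insert_if)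

lemma card_compl_edges:
  assumes "simple_graph V E"
  shows "card (compl_edges V E) + card E = card V choose 2"
proof -
  have fin: "finite V" using assms by (simp add: simple_graph_def)
  have sub: "E \<subseteq> {e. e \<subseteq> V \<and> card e = 2}" using assms by (auto simp: simple_graph_def)
  have "card {e. e \<subseteq> V \<and> card e = 2} = card V choose 2" by (rule n_subsets[OF fin])
  moreover have "finite {e. e \<subseteq> V \<and> card e = 2}" using fin by simp
  ultimately show ?thesis unfolding compl_edges_def
    using card_Diff_subset[OF finite_edges[OF assms] sub] card_mono[OF _ sub] by simp
qed

lemma graph_lap_compl:
  fixes f :: "'a \<Rightarrow> real"
  assumes g: "simple_graph V E" and u: "u \<in> V"
  shows "graph_lap V (compl_edges V E) f u = card V * f u - (\<Sum>w\<in>V. f w) - graph_lap V E f u"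
proof -
  have "graph_lap V (compl_edges V E) f u = (\<Sum>w\<in>V. (f u - f w) - (if {u, w} \<in> E then f u - f w else 0))"
    unfolding graph_lap_def using u by (intro sum.cong refl) (auto simp: compl_edges_iff)
  then show ?thesis by (simp add: sum_subtractf graph_lap_def)
qed

text \<open>The two Laplacians add up to that of the complete graph, which is \<open>card V\<close>
  times the identity on functions orthogonal to constants. The index \<open>card V - 2 - i\<close>
  reverses all positions except the last, kept for the constant.\<close>

lemma eigensystem_compl:
  assumes g: "simple_graph V E" and es: "eigensystem V E v l"
  shows "\<exists>v'. eigensystem V (compl_edges V E) v'
    (\<lambda>i. if i < card V - 1 then real (card V) - l (card V - 2 - i) else 0)"
proof -
  let ?n = "card V"
  define v' where "v' i = (if i < ?n - 1 then v (?n - 2 - i) else v i)" for i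
  define l' where "l' i = (if i < ?n - 1 then real ?n - l (?n - 2 - i) else 0)" for i
  have fin: "finite V" using g by (simp add: simple_graph_def)
  have o: "orthonormal_on V ?n v'"
    unfolding orthonormal_on_ip
  proof (intro allI impI)
    fix i j assume ij: "i < ?n" "j < ?n"
    define p where "p i = (if i < ?n - 1 then ?n - 2 - i else i)" for i
    have "p i < ?n" "p j < ?n" "p i = p j \<longleftrightarrow> i = j" using ij by (auto simp: p_def split: if_splits)
    moreover have "v' i = v (p i)" for i by (simp add: v'_def p_def)
    ultimately show "ip V (v' i) (v' j) = (if i = j then 1 else 0)"
      using eigensystemD(1)[OF es] by (simp add: orthonormal_on_ip)
  qed
  have eig: "graph_lap V (compl_edges V E) (v' i) u = l' i * v' i u" if i: "i < ?n" and u: "u \<in> V" for i u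
  proof (cases "i < ?n - 1")
    case True
    then have "graph_lap V E (v (?n - 2 - i)) u = l (?n - 2 - i) * v (?n - 2 - i) u"
      "(\<Sum>w\<in>V. v (?n - 2 - i) w) = 0"
      using eigensystemD(2)[OF es _ u] eigensystem_perp[OF es] by auto
    then show ?thesis using True by (simp add: graph_lap_compl[OF g u] v'_def l'_def left_diff_distrib)
  next
    case False
    then have "i = ?n - 1" using i by simp
    then have "graph_lap V (compl_edges V E) (v' i) u = 0"
      unfolding graph_lap_def using eigensystemD(4)[OF es] u by (intro sum.neutral) (simp add: v'_def)
    then show ?thesis using False by (simp add: l'_def)
  qed
  \<comment> \<open>Positivity for the complement means that eigenvalues never exceed
    \<open>card V\<close>; this keeps the order correct at the final entry 0.\<close>
  have "0 \<le> l' i" if i: "i < ?n" for i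
  proof -
    have "ip V (v' i) (graph_lap V (compl_edges V E) (v' i)) = ip V (v' i) (\<lambda>u. l' i * v' i u)"
      by (rule ip_cong) (simp_all add: eig[OF i])
    also have "\<dots> = l' i" using o i by (simp add: ip_scale_right orthonormal_on_ip)
    finally show ?thesis using ip_graph_lap_nonneg[of V "v' i" "compl_edges V E"] by simp
  qed
  then have "l' j \<le> l' i" if "i \<le> j" "j < ?n" for i j
    using that eigensystemD(3)[OF es, of "?n - 2 - j" "?n - 2 - i"]
    by (cases "j < ?n - 1") (auto simp: l'_def)
  then have "eigensystem V (compl_edges V E) v' l'"
    unfolding eigensystem_def using o eig eigensystemD(4)[OF es] by (simp add: v'_def)
  then show ?thesis unfolding l'_def by blast
qed

subsection \<open>Split graphs\<close>

text \<open>Equivalently, the neighbourhoods in \<open>I\<close> of the vertices of \<open>K\<close>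
  form a chain under inclusion.\<close>

definition alternating_free :: "'a set \<Rightarrow> 'a set \<Rightarrow> 'a set set \<Rightarrow> bool" where
  "alternating_free K I E \<longleftrightarrow> \<not> (\<exists>i\<in>K. \<exists>i'\<in>K. \<exists>m\<in>I. \<exists>m'\<in>I.
     {i, m} \<in> E \<and> {i', m'} \<in> E \<and> {i, m'} \<notin> E \<and> {i', m} \<notin> E)"

lemma real_choose_two: "real (n choose 2) = real n * (real n - 1) / 2"
proof -
  have "even (n * (n - 1))" by auto
  then have "real (n choose 2) = real (n * (n - 1)) / 2"
    unfolding choose_two by (simp add: real_of_nat_div)
  also have "real (n * (n - 1)) = real n * (real n - 1)" by (cases n) (auto simp: algebra_simps)
  finally show ?thesis .
qed

locale split_partition =
  fixes V K I :: "'a set" and E :: "'a set set"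
  assumes g: "simple_graph V E" and part: "K \<union> I = V" "K \<inter> I = {}"
    and cl: "is_clique V E K" and ind: "is_independent V E I"
begin

definition B :: "'a \<Rightarrow> 'a \<Rightarrow> real" where "B i m = (if {i, m} \<in> E then 1 else 0)"

lemma finV: "finite V" and finKI: "finite K" "finite I"
  using g part(1) by (auto simp: simple_graph_def)

lemma not_edge_self: "{u, u} \<notin> E"
  using simple_graph_edgeD(1)[OF g, of u u] by blast

sublocale bipartite_weights K I B
  by unfold_locales (use finKI part in \<open>auto simp: B_def\<close>)

lemma lap_eq_graph_lap:
  assumes u: "u \<in> V"
  shows "lap f u = graph_lap V E f u"
proof -
  have split: "graph_lap V E f u = (\<Sum>w\<in>K. if {u, w} \<in> E then f u - f w else 0)
      + (\<Sum>w\<in>I. if {u, w} \<in> E then f u - f w else 0)"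
    unfolding graph_lap_def part(1)[symmetric] by (rule sum.union_disjoint[OF finKI part(2)])
  show ?thesis
  proof (cases "u \<in> K")
    case True
    have "(\<Sum>w\<in>K. if {u, w} \<in> E then f u - f w else 0) = (\<Sum>w\<in>K. f u - f w)"
      using cl True by (intro sum.cong refl) (auto simp: is_clique_def)
    moreover have "(\<Sum>w\<in>I. if {u, w} \<in> E then f u - f w else 0) = (\<Sum>w\<in>I. B u w * f u - B u w * f w)"
      by (intro sum.cong refl) (simp add: B_def)
    ultimately show ?thesis using True split
      by (simp add: lap_def dK_def sum_subtractf sum_distrib_right distrib_right)
  next
    case False
    then have uI: "u \<in> I" using u part(1) by blast
    have "(\<Sum>w\<in>I. if {u, w} \<in> E then f u - f w else 0) = 0"
      using ind uI by (intro sum.neutral) (auto simp: is_independent_def)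
    moreover have "(\<Sum>w\<in>K. if {u, w} \<in> E then f u - f w else 0) = (\<Sum>w\<in>K. B w u * f u - B w u * f w)"
      by (intro sum.cong refl) (simp add: B_def insert_commute)
    ultimately show ?thesis using False split
      by (simp add: lap_def dI_def sum_subtractf sum_distrib_right)
  qed
qed

lemma card_edges: "real (card E) = card K * (real (card K) - 1) / 2 + (\<Sum>i\<in>K. dK i)"
proof -
  have "2 * real (card E) = (\<Sum>u\<in>V. real (degree_of E u))"
    using handshake[OF g] by (metis of_nat_mult of_nat_numeral of_nat_sum)
  also have "\<dots> = (\<Sum>u\<in>K. real (degree_of E u)) + (\<Sum>u\<in>I. real (degree_of E u))"
    unfolding part(1)[symmetric] by (rule sum.union_disjoint[OF finKI part(2)])
  also have "(\<Sum>u\<in>K. real (degree_of E u)) = (\<Sum>u\<in>K. real (card K) - 1 + dK u)"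
  proof (intro sum.cong refl)
    fix u assume u: "u \<in> K"
    have "real (degree_of E u) = (\<Sum>w\<in>K. if {u, w} \<in> E then 1 else 0) + dK u"
      unfolding real_degree_of[OF g] part(1)[symmetric] dK_def B_def
      by (rule sum.union_disjoint[OF finKI part(2)])
    also have "(\<Sum>w\<in>K. if {u, w} \<in> E then 1 else 0 :: real) = (\<Sum>w\<in>K. 1 - (if u = w then 1 else 0))"
      using cl u not_edge_self by (intro sum.cong refl) (auto simp: is_clique_def)
    also have "\<dots> = real (card K) - 1" using u finKI by (simp add: sum_subtractf)
    finally show "real (degree_of E u) = real (card K) - 1 + dK u" .
  qed
  also have "(\<Sum>u\<in>I. real (degree_of E u)) = (\<Sum>u\<in>I. dI u)"
  proof (intro sum.cong refl)
    fix u assume u: "u \<in> I"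
    have "real (degree_of E u) = (\<Sum>w\<in>K. if {u, w} \<in> E then 1 else 0) + (\<Sum>w\<in>I. if {u, w} \<in> E then 1 else 0)"
      unfolding real_degree_of[OF g] part(1)[symmetric] by (rule sum.union_disjoint[OF finKI part(2)])
    also have "(\<Sum>w\<in>I. if {u, w} \<in> E then 1 else 0 :: real) = 0"
      using ind u by (intro sum.neutral) (auto simp: is_independent_def)
    finally show "real (degree_of E u) = dI u" by (simp add: dI_def B_def insert_commute)
  qed
  also have "\<dots> = (\<Sum>i\<in>K. dK i)" unfolding dI_def dK_def by (rule sum.swap)
  finally show ?thesis by (simp add: sum.distrib)
qed

text \<open>Some combination of the first \<open>i + 1\<close> eigenfunctions vanishes on \<open>K\<close>, and on such functions
  the Laplacian is diagonal with entries at most \<open>card K\<close>.\<close>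

lemma tail_eigenvalue_le:
  assumes es: "eigensystem V E v l" and i: "card K \<le> i" "i < card V"
  shows "l i \<le> card K"
proof -
  note o = eigensystemD(1)[OF es]
  have "card K < card {..i}" using i by simp
  then obtain z where z: "\<And>w. w \<in> K \<Longrightarrow> (\<Sum>j\<le>i. v j w * z j) = 0" "\<exists>j\<in>{..i}. z j \<noteq> 0"
    using underdetermined_system[OF finKI(1), of "{..i}" "\<lambda>w j. v j w"] by auto
  define f where "f w = (\<Sum>j\<le>i. z j * v j w)" for w
  have fK: "f w = 0" if "w \<in> K" for w using z(1)[OF that] by (simp add: f_def mult.commute)
  have "{..i} \<subseteq> {..<card V}" using i(2) by auto
  then have vf: "ip V (v j) f = z j" if "j \<le> i" for j
    using orthonormal_combination_coeff[OF finV o, of "{..i}" j z] i(2) that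
    by (simp add: ip_def f_def)
  have "ip V f f = (\<Sum>j\<le>i. z j * ip V f (v j))"
    unfolding f_def[abs_def] ip_sum_right ip_scale_right ..
  also have "\<dots> = (\<Sum>j\<le>i. z j * z j)" by (intro sum.cong refl) (simp add: ip_commute[of V f] vf)
  finally have ff: "ip V f f = (\<Sum>j\<le>i. z j * z j)" .
  have pos: "0 < ip V f f"
  proof -
    obtain j where j: "j \<in> {..i}" "z j \<noteq> 0" using z(2) by blast
    have "0 < z j * z j" using j(2) not_real_square_gt_zero by blast
    also have "\<dots> \<le> (\<Sum>j\<le>i. z j * z j)" using j(1) by (intro member_le_sum) auto
    finally show ?thesis using ff by simp
  qed
  have "ip V f (lap f) = ip V f (\<lambda>w. \<Sum>j\<le>i. z j * (l j * v j w))"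
  proof (rule ip_cong)
    fix w assume w: "w \<in> V"
    have "lap f w = (\<Sum>j\<le>i. z j * lap (v j) w)" unfolding f_def[abs_def] by (rule lap_sum)
    also have "\<dots> = (\<Sum>j\<le>i. z j * (l j * v j w))"
    proof (intro sum.cong refl)
      fix j assume "j \<in> {..i}"
      then show "z j * lap (v j) w = z j * (l j * v j w)"
        using eigensystemD(2)[OF es _ w, of j] i(2) by (simp add: lap_eq_graph_lap[OF w])
    qed
    finally show "lap f w = (\<Sum>j\<le>i. z j * (l j * v j w))" .
  qed simp
  also have "\<dots> = (\<Sum>j\<le>i. z j * (l j * ip V f (v j)))"
    by (simp only: ip_sum_right ip_scale_right)
  also have "\<dots> = (\<Sum>j\<le>i. l j * (z j * z j))"
    by (intro sum.cong refl) (simp add: ip_commute[of V f] vf)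
  also have "\<dots> \<ge> (\<Sum>j\<le>i. l i * (z j * z j))"
    using eigensystemD(3)[OF es _ i(2)] by (intro sum_mono mult_right_mono) auto
  finally have "l i * ip V f f \<le> ip V f (lap f)" unfolding ff sum_distrib_left .
  also have "ip V f (lap f) = (\<Sum>w\<in>I. f w * lap f w)"
    unfolding ip_def using finV part fK by (intro sum.mono_neutral_right) auto
  also have "\<dots> \<le> (\<Sum>w\<in>I. card K * (f w * f w))"
  proof (intro sum_mono)
    fix w assume w: "w \<in> I"
    then have "w \<notin> K" using part(2) by blast
    then have "lap f w = dI w * f w" using fK by (simp add: lap_def)
    moreover have "dI w \<le> (\<Sum>i\<in>K. 1)" unfolding dI_def by (intro sum_mono) (simp add: B_def)
    then have "dI w * (f w * f w) \<le> card K * (f w * f w)" by (intro mult_right_mono) auto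
    ultimately show "f w * lap f w \<le> card K * (f w * f w)" by (simp add: mult.left_commute)
  qed
  also have "\<dots> = card K * ip V f f"
    unfolding ip_def sum_distrib_left[symmetric] using finV part fK
    by (intro arg_cong[where f = "\<lambda>x. _ * x"] sum.mono_neutral_left) auto
  finally show ?thesis using pos by simp
qed

text \<open>The first \<open>card K\<close> eigenvalues contribute at most c^2 + e and each later
  one at most c. Against the claimed bound this leaves the slack (k - c)(k - c + 1)/2, which
  vanishes only for k = c.\<close>

lemma clique_side_bound:
  assumes es: "eigensystem V E v l" and k: "card K \<le> k" "k < card V"
  shows "(\<Sum>i<k. l i) \<le> card E + real ((k + 1) choose 2)"
    and "(\<Sum>i<k. l i) = card E + real ((k + 1) choose 2) \<Longrightarrow>
      card K = k \<and> (\<forall>i\<in>K. \<exists>m\<in>I. {i, m} \<in> E) \<and> alternating_free K I E"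
proof -
  let ?c = "card K"
  have I0: "I \<noteq> {}" using k part(1) by auto
  have o: "orthonormal_on (K \<union> I) (card (K \<union> I)) v" using eigensystemD(1)[OF es] part(1) by simp
  have eig: "\<forall>i<card (K \<union> I). \<forall>w\<in>K \<union> I. lap (v i) w = l i * v i w"
    using eigensystemD(2)[OF es] lap_eq_graph_lap part(1) by simp
  have anti: "\<forall>i j. i \<le> j \<longrightarrow> j < card (K \<union> I) \<longrightarrow> l j \<le> l i"
    using eigensystemD(3)[OF es] part(1) by simp
  have nonneg: "\<forall>i<card (K \<union> I). 0 \<le> l i" using eigensystem_nonneg[OF es] part(1) by simp
  have perp: "\<forall>i<card K. (\<Sum>w\<in>K \<union> I. v i w) = 0" using eigensystem_perp[OF es] k part(1) by simp
  have B01: "B i m = 0 \<or> B i m = 1" for i m by (simp add: B_def)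
  have head: "(\<Sum>i<?c. l i) \<le> (real ?c)\<^sup>2 + (\<Sum>i\<in>K. dK i)"
    using top_eigenvalue_sum_le(1)[OF I0 o eig anti nonneg perp B01] by simp
  have "(\<Sum>i<k. l i) = (\<Sum>i<?c. l i) + (\<Sum>i=?c..<k. l i)"
    using k(1) by (simp add: sum.lessThan_Suc lessThan_atLeast0 sum.atLeastLessThan_concat)
  also have "(\<Sum>i=?c..<k. l i) \<le> (\<Sum>i=?c..<k. real ?c)"
    using k(2) by (intro sum_mono tail_eigenvalue_le[OF es]) auto
  also have "\<dots> = (real k - real ?c) * real ?c" using k(1) by (simp add: of_nat_diff)
  finally have S: "(\<Sum>i<k. l i) \<le> (\<Sum>i<?c. l i) + (real k - real ?c) * real ?c" by simp
  have id: "card E + real ((k + 1) choose 2)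
      = (real ?c)\<^sup>2 + (\<Sum>i\<in>K. dK i) + (real k - real ?c) * real ?c
        + (real k - real ?c) * (real k - real ?c + 1) / 2"
    unfolding card_edges real_choose_two by (simp add: power2_eq_square field_simps)
  have gap: "0 \<le> (real k - real ?c) * (real k - real ?c + 1) / 2" using k(1) by simp
  show "(\<Sum>i<k. l i) \<le> card E + real ((k + 1) choose 2)"
    unfolding id using S head gap by linarith
  assume eq: "(\<Sum>i<k. l i) = card E + real ((k + 1) choose 2)"
  then have "(real k - real ?c) * (real k - real ?c + 1) / 2 = 0"
    unfolding id using S head gap by linarith
  then have ck: "?c = k" using k(1) by simp
  then have "(\<Sum>i<card K. l i) = (card K)\<^sup>2 + (\<Sum>i\<in>K. dK i)"
    using eq unfolding id by simp
  from top_eigenvalue_sum_le(2)[OF I0 o eig anti nonneg perp B01 this]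
  have "(\<forall>i\<in>K. \<exists>m\<in>I. B i m = 1) \<and>
      \<not> (\<exists>i\<in>K. \<exists>i'\<in>K. \<exists>m\<in>I. \<exists>m'\<in>I. B i m = 1 \<and> B i' m' = 1 \<and> B i m' = 0 \<and> B i' m = 0)" .
  moreover have "B i m = 1 \<longleftrightarrow> {i, m} \<in> E" "B i m = 0 \<longleftrightarrow> {i, m} \<notin> E" for i m by (simp_all add: B_def)
  ultimately show "card K = k \<and> (\<forall>i\<in>K. \<exists>m\<in>I. {i, m} \<in> E) \<and> alternating_free K I E"
    using ck unfolding alternating_free_def by simp
qed

end

lemma split_partition_compl:
  assumes "split_partition V K I E"
  shows "split_partition V I K (compl_edges V E)"
proof -
  interpret split_partition V K I E by fact
  have "I \<subseteq> V" "K \<subseteq> V" using part by auto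
  then show ?thesis
    using part cl ind simple_graph_compl[OF finV] compl_edges_iff
    unfolding split_partition_def is_clique_def is_independent_def
    by (auto simp: compl_edges_iff subset_iff)
qed

text \<open>For \<open>k < card K\<close> pass to the complement: its clique is \<open>I\<close>, its eigenvalues are \<open>n - l\<close> in
  reverse order apart from the trivial one, and \<open>k\<close> becomes \<open>n - 1 - k\<close>.\<close>

lemma split_graph_bound:
  assumes sp: "split_partition V K I E" and es: "eigensystem V E v l" and k: "k < card V"
  shows "(\<Sum>i<k. l i) \<le> card E + real ((k + 1) choose 2)"
    and "(\<Sum>i<k. l i) = card E + real ((k + 1) choose 2) \<Longrightarrow> alternating_free K I E \<and>
      (card K = k \<and> (\<forall>i\<in>K. \<exists>m\<in>I. {i, m} \<in> E) \<or>
       card K = k + 1 \<and> (\<forall>m\<in>I. \<exists>i\<in>K. {i, m} \<notin> E))"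
proof -
  interpret split_partition V K I E by fact
  have "(\<Sum>i<k. l i) \<le> card E + real ((k + 1) choose 2) \<and>
    ((\<Sum>i<k. l i) = card E + real ((k + 1) choose 2) \<longrightarrow> alternating_free K I E \<and>
      (card K = k \<and> (\<forall>i\<in>K. \<exists>m\<in>I. {i, m} \<in> E) \<or>
       card K = k + 1 \<and> (\<forall>m\<in>I. \<exists>i\<in>K. {i, m} \<notin> E)))"
  proof (cases "card K \<le> k")
    case True
    then show ?thesis using clique_side_bound[OF es True k] by blast
  next
    case False
    interpret c: split_partition V I K "compl_edges V E" by (rule split_partition_compl[OF sp])
    define n where "n = card V"
    define k' where "k' = n - 1 - k"
    have card_n: "card K + card I = n"
      using card_Un_disjoint[OF finKI part(2)] part(1) by (simp add: n_def)
    have k': "card I \<le> k'" "k' < n" "k' + k + 1 = n" using False card_n k by (auto simp: k'_def n_def)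
    obtain v' where es': "eigensystem V (compl_edges V E) v'
        (\<lambda>i. if i < card V - 1 then real (card V) - l (card V - 2 - i) else 0)" (is "eigensystem _ _ _ ?l")
      using eigensystem_compl[OF g es] by blast
    have nz: "n \<noteq> 0" using k n_def by simp
    then have V0: "V \<noteq> {}" by (auto simp: n_def)
    have "(\<Sum>i<k'. ?l i) = (\<Sum>i<k'. real n - l (n - 2 - i))"
      using k' by (intro sum.cong refl) (auto simp: n_def)
    also have "\<dots> = real k' * real n - (\<Sum>i<k'. l (n - 2 - i))" by (simp add: sum_subtractf)
    \<comment> \<open>The reversed indices run through \<open>k\<close>, ..., \<open>n - 2\<close>,
      stopping short of the trivial eigenvalue at \<open>n - 1\<close>.\<close>
    also have "(\<Sum>i<k'. l (n - 2 - i)) = (\<Sum>i<k'. l (k + i))"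
    proof -
      have "(\<Sum>i<k'. l (n - 2 - i)) = (\<Sum>i<k'. l (k + (k' - Suc i)))"
        using k' by (intro sum.cong refl arg_cong[where f = l]) auto
      also have "\<dots> = (\<Sum>i<k'. l (k + i))" by (rule sum.nat_diff_reindex)
      finally show ?thesis .
    qed
    also have "\<dots> = 2 * card E - (\<Sum>i<k. l i)"
    proof -
      have "(\<Sum>i<n. l i) = (\<Sum>i<k + k'. l i) + l (n - 1)"
      proof -
        have "n = Suc (k + k')" using k' by simp
        then show ?thesis by simp
      qed
      moreover have "(\<Sum>i<k + k'. l i) = (\<Sum>i<k. l i) + (\<Sum>i<k'. l (k + i))"
        by (induction k') simp_all
      ultimately show ?thesis
        using eigensystem_trace[OF g es] eigensystem_last[OF es finV V0] by (simp add: n_def)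
    qed
    finally have S: "(\<Sum>i<k'. ?l i) = real k' * real n - 2 * card E + (\<Sum>i<k. l i)" by simp
    have "real (card (compl_edges V E)) = real (n choose 2) - card E"
      using card_compl_edges[OF g] by (simp add: n_def flip: of_nat_add)
    moreover have "real (n choose 2) + real ((k' + 1) choose 2) - real k' * real n = real ((k + 1) choose 2)"
      unfolding real_choose_two k'(3)[symmetric] by (simp add: field_simps)
    \<comment> \<open>The excess over the bound is the same for the graph with \<open>k\<close> and
      its complement with \<open>k'\<close>, so inequality and equality transfer together.\<close>
    ultimately have iff: "(\<Sum>i<k'. ?l i) - (card (compl_edges V E) + real ((k' + 1) choose 2))
      = (\<Sum>i<k. l i) - (card E + real ((k + 1) choose 2))"
      unfolding S by linarith
    have "(\<Sum>i<k'. ?l i) \<le> card (compl_edges V E) + real ((k' + 1) choose 2)"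
      by (rule c.clique_side_bound(1)[OF es' k'(1)]) (use k'(2) n_def in simp)
    moreover have "alternating_free K I E \<and> card K = k + 1 \<and> (\<forall>m\<in>I. \<exists>i\<in>K. {i, m} \<notin> E)"
      if "(\<Sum>i<k. l i) = card E + real ((k + 1) choose 2)"
    proof -
      have "(\<Sum>i<k'. ?l i) = card (compl_edges V E) + real ((k' + 1) choose 2)"
        using iff that by linarith
      from c.clique_side_bound(2)[OF es' k'(1) _ this] k'(2)
      have *: "card I = k'" "\<forall>m\<in>I. \<exists>i\<in>K. {m, i} \<in> compl_edges V E"
        "alternating_free I K (compl_edges V E)" by (auto simp: n_def)
      have mem: "{m, i} \<in> compl_edges V E \<longleftrightarrow> {i, m} \<notin> E" if "i \<in> K" "m \<in> I" for i m
        using that part compl_edges_iff[of m V i E] by (auto simp: insert_commute)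
      have "\<forall>m\<in>I. \<exists>i\<in>K. {i, m} \<notin> E" using *(2) mem by blast
      moreover have "alternating_free K I E"
        using *(3) mem unfolding alternating_free_def by blast
      moreover have "card K = k + 1" using *(1) card_n k'(3) by simp
      ultimately show ?thesis by blast
    qed
    ultimately show ?thesis using iff by auto
  qed
  then show "(\<Sum>i<k. l i) \<le> card E + real ((k + 1) choose 2)"
    and "(\<Sum>i<k. l i) = card E + real ((k + 1) choose 2) \<Longrightarrow> alternating_free K I E \<and>
      (card K = k \<and> (\<forall>i\<in>K. \<exists>m\<in>I. {i, m} \<in> E) \<or>
       card K = k + 1 \<and> (\<forall>m\<in>I. \<exists>i\<in>K. {i, m} \<notin> E))" by blast+
qed

subsection \<open>Threshold graphs and clique numbers\<close>

lemma finite_cliques: "finite V \<Longrightarrow> finite {Q. is_clique V E Q}"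
  by (rule finite_subset[of _ "Pow V"]) (auto simp: is_clique_def)

lemma clique_number_ge: "finite V \<Longrightarrow> is_clique V E Q \<Longrightarrow> card Q \<le> clique_number V E"
  unfolding clique_number_def using finite_cliques[of V E] by (intro Max_ge) auto

lemma clique_number_attained:
  assumes "finite V"
  obtains Q where "is_clique V E Q" "card Q = clique_number V E"
proof -
  have "is_clique V E {}" by (simp add: is_clique_def)
  then have "clique_number V E \<in> card ` {Q. is_clique V E Q}"
    unfolding clique_number_def using finite_cliques[OF assms, of E] by (intro Max_in) auto
  then show thesis using that by auto
qed

lemma clique_number_eqI:
  assumes "finite V" "is_clique V E Q" "\<And>Q'. is_clique V E Q' \<Longrightarrow> card Q' \<le> card Q"
  shows "clique_number V E = card Q"
  unfolding clique_number_def using finite_cliques[OF assms(1), of E] assms(2,3)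
  by (intro Max_eqI) auto

lemma clique_number_bounds:
  assumes "finite V" "V \<noteq> {}"
  shows "1 \<le> clique_number V E" "clique_number V E \<le> card V"
proof -
  obtain z where "z \<in> V" using assms by blast
  then have "is_clique V E {z}" by (simp add: is_clique_def)
  then show "1 \<le> clique_number V E" using clique_number_ge[OF assms(1)] by fastforce
  obtain Q where "is_clique V E Q" "card Q = clique_number V E"
    by (rule clique_number_attained[OF assms(1)])
  then show "clique_number V E \<le> card V"
    using card_mono[OF assms(1), of Q] by (simp add: is_clique_def)
qed

lemma alternating_free_swap: "alternating_free K I E \<Longrightarrow> alternating_free I K E"
  unfolding alternating_free_def by (subst (asm) (1 2 3 4) insert_commute) blast

text \<open>The neighbourhoods in \<open>I\<close> form a chain, so the smallest one, which is
  nonempty, lies in all the others.\<close>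

lemma common_neighbour:
  assumes fin: "finite I" and K0: "K \<noteq> {}" and nb: "\<forall>i\<in>K. \<exists>m\<in>I. {i, m} \<in> E"
    and af: "alternating_free K I E"
  shows "\<exists>m\<in>I. \<forall>i\<in>K. {i, m} \<in> E"
proof -
  define N where "N i = {m \<in> I. {i, m} \<in> E}" for i
  obtain i0 where "i0 \<in> K" using K0 by blast
  then obtain i where i: "i \<in> K" and min: "\<forall>j. j \<in> K \<longrightarrow> card (N i) \<le> card (N j)"
    using ex_has_least_nat[of "\<lambda>i. i \<in> K" i0 "\<lambda>i. card (N i)"] by blast
  obtain m where m: "m \<in> I" "{i, m} \<in> E" using nb i by blast
  have "{j, m} \<in> E" if j: "j \<in> K" for j
  proof (rule ccontr)
    assume notin: "{j, m} \<notin> E"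
    have "N j \<subseteq> N i - {m}"
      using af i j m notin unfolding alternating_free_def N_def by blast
    moreover have "m \<in> N i" "finite (N i)" using m fin by (auto simp: N_def)
    ultimately have "card (N j) < card (N i)"
      by (metis card_Diff1_less card_mono finite_Diff le_less_trans)
    then show False using min j by (simp add: not_le[symmetric])
  qed
  then show ?thesis using m(1) by blast
qed

text \<open>Agreement of \<open>E'\<close> with \<open>E\<close> away from \<open>z\<close> covers
  both deletions: of an isolated vertex, where the edge set stays, and of a dominating one, where
  the edges at \<open>z\<close> go.\<close>

lemma split_partition_remove:
  assumes sp: "split_partition V K I E" and af: "alternating_free K I E"
    and E': "\<And>u w. u \<noteq> z \<Longrightarrow> w \<noteq> z \<Longrightarrow> {u, w} \<in> E' \<longleftrightarrow> {u, w} \<in> E"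
    and g': "simple_graph (V - {z}) E'"
  shows "split_partition (V - {z}) (K - {z}) (I - {z}) E'" "alternating_free (K - {z}) (I - {z}) E'"
proof -
  interpret split_partition V K I E by fact
  show "split_partition (V - {z}) (K - {z}) (I - {z}) E'"
  proof
    show "is_clique (V - {z}) E' (K - {z})"
      using cl part(1) E' unfolding is_clique_def by auto
    show "is_independent (V - {z}) E' (I - {z})"
      using ind part(1) E' unfolding is_independent_def by auto
  qed (use part g' in auto)
  show "alternating_free (K - {z}) (I - {z}) E'"
    using af E' unfolding alternating_free_def by auto
qed

text \<open>Vertices are peeled off one by one. If none is isolated, every vertex of
  \<open>I\<close> has a neighbour in \<open>K\<close>, and nestedness provides a vertex of
  \<open>K\<close> adjacent to all of \<open>I\<close>; as \<open>K\<close> is a clique, that vertex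
  is dominating.\<close>

lemma nested_split_threshold:
  assumes "split_partition V K I E" "alternating_free K I E" "V \<noteq> {}"
  shows "threshold_graph V E"
  using assms
proof (induction "card V" arbitrary: V K I E rule: less_induct)
  case less
  interpret split_partition V K I E by (rule less.prems(1))
  have small: "card (V - {z}) < card V" if "z \<in> V" for z
    using that finV by (rule card_Diff1_less[rotated])
  have single: "threshold_graph V E" if "V = {z}" for z
  proof -
    have "E = {}"
    proof (rule ccontr)
      assume "E \<noteq> {}"
      then obtain e where "e \<in> E" by blast
      then show False using simple_graph_edgeE[OF g] that by (metis singletonD)
    qed
    then show ?thesis using that threshold_graph.single by simp
  qed
  show ?case
  proof (cases "\<exists>z\<in>V. \<forall>u\<in>V. {u, z} \<notin> E")
    case True
    then obtain z where z: "z \<in> V" "\<forall>u\<in>V. {u, z} \<notin> E" by blast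
    show ?thesis
    proof (cases "V - {z} = {}")
      case True
      then show ?thesis using single[of z] z(1) by blast
    next
      case False
      have "simple_graph (V - {z}) E" unfolding simple_graph_def
      proof (intro conjI ballI)
        fix e assume e: "e \<in> E"
        then obtain a b where "e = {a, b}" "a \<noteq> b" "a \<in> V" "b \<in> V"
          by (rule simple_graph_edgeE[OF g])
        then show "e \<subseteq> V - {z}" "card e = 2" using z(2) e by (auto simp: insert_commute)
      qed (use finV in simp)
      from split_partition_remove[OF less.prems(1,2) refl this]
      have "threshold_graph (V - {z}) E"
        using less.hyps[OF small[OF z(1)]] False by blast
      from threshold_graph.isolated[OF this, of z] show ?thesis
        using z(1) by (simp add: insert_absorb)
    qed
  next
    case nonisolated: False
    have "\<exists>z\<in>V. \<forall>u\<in>V - {z}. {u, z} \<in> E"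
    proof (cases "I = {}")
      case True
      then show ?thesis using less.prems(3) cl part(1) unfolding is_clique_def by blast
    next
      case False
      have "\<forall>m\<in>I. \<exists>i\<in>K. {m, i} \<in> E"
      proof
        fix m assume m: "m \<in> I"
        then obtain u where u: "u \<in> V" "{u, m} \<in> E" using nonisolated part(1) by blast
        then have "u \<in> K" using ind m part(1) unfolding is_independent_def by blast
        then show "\<exists>i\<in>K. {m, i} \<in> E" using u(2) by (auto simp: insert_commute)
      qed
      from common_neighbour[OF finKI(1) False this alternating_free_swap[OF less.prems(2)]]
      obtain i where i: "i \<in> K" "\<forall>m\<in>I. {m, i} \<in> E" by blast
      then have "{u, i} \<in> E" if "u \<in> V - {i}" for u
        using that cl part(1) unfolding is_clique_def by blast
      then show ?thesis using i(1) part(1) by blast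
    qed
    then obtain z where z: "z \<in> V" "\<forall>u\<in>V - {z}. {u, z} \<in> E" by blast
    show ?thesis
    proof (cases "V - {z} = {}")
      case True
      then show ?thesis using single[of z] z(1) by blast
    next
      case False
      define E' where "E' = {e \<in> E. z \<notin> e}"
      have g': "simple_graph (V - {z}) E'"
        using g unfolding simple_graph_def E'_def by auto
      have "{u, w} \<in> E' \<longleftrightarrow> {u, w} \<in> E" if "u \<noteq> z" "w \<noteq> z" for u w
        using that by (simp add: E'_def)
      from split_partition_remove[OF less.prems(1,2) this g']
      have "threshold_graph (V - {z}) E'"
        using less.hyps[OF small[OF z(1)]] False by blast
      from threshold_graph.dominating[OF this, of z]
      have "threshold_graph V (E' \<union> (\<lambda>u. {u, z}) ` (V - {z}))"
        using z(1) by (simp add: insert_absorb)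
      also have "E' \<union> (\<lambda>u. {u, z}) ` (V - {z}) = E"
      proof
        show "E' \<union> (\<lambda>u. {u, z}) ` (V - {z}) \<subseteq> E" using z(2) by (auto simp: E'_def)
        show "E \<subseteq> E' \<union> (\<lambda>u. {u, z}) ` (V - {z})"
        proof
          fix e assume e: "e \<in> E"
          then obtain a b where ab: "e = {a, b}" "a \<noteq> b" "a \<in> V" "b \<in> V"
            by (rule simple_graph_edgeE[OF g])
          show "e \<in> E' \<union> (\<lambda>u. {u, z}) ` (V - {z})"
          proof (cases "z \<in> e")
            case True
            then have "e = {b, z} \<and> b \<noteq> z \<or> e = {a, z} \<and> a \<noteq> z" using ab by auto
            then show ?thesis using ab by blast
          qed (use e in \<open>simp add: E'_def\<close>)
        qed
      qed
      finally show ?thesis .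
    qed
  qed
qed

context split_partition
begin

lemma clique_independent_part_le: "is_clique V E Q \<Longrightarrow> m \<in> Q \<inter> I \<Longrightarrow> Q \<subseteq> insert m {i \<in> K. {i, m} \<in> E}"
  using ind part unfolding is_clique_def is_independent_def by blast

text \<open>In this equality case \<open>K\<close> is not a maximum clique: a common neighbour in
  \<open>I\<close> enlarges it, and no clique contains a second vertex of \<open>I\<close>.\<close>

lemma clique_number_dominated:
  assumes "K \<noteq> {}" "\<forall>i\<in>K. \<exists>m\<in>I. {i, m} \<in> E" "alternating_free K I E"
  shows "clique_number V E = card K + 1"
proof -
  obtain m where m: "m \<in> I" "\<forall>i\<in>K. {i, m} \<in> E"
    using common_neighbour[OF finKI(2) assms] by blast
  have mK: "m \<notin> K" using m(1) part(2) by blast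
  have "is_clique V E (insert m K)"
    using cl m part(1) unfolding is_clique_def by (auto simp: insert_commute)
  moreover have "card Q \<le> card (insert m K)" if Q: "is_clique V E Q" for Q
  proof (cases "Q \<inter> I = {}")
    case True
    then have "Q \<subseteq> insert m K" using Q part(1) unfolding is_clique_def by blast
    then show ?thesis using finKI by (intro card_mono) auto
  next
    case False
    then obtain m' where "m' \<in> Q \<inter> I" by blast
    then have "Q \<subseteq> insert m' K" using clique_independent_part_le[OF Q] by blast
    then have "card Q \<le> card (insert m' K)" using finKI by (intro card_mono) auto
    also have "\<dots> \<le> card (insert m K)" using finKI mK by (simp add: card_insert_if)
    finally show ?thesis .
  qed
  ultimately have "clique_number V E = card (insert m K)" by (rule clique_number_eqI[OF finV])
  then show ?thesis using mK finKI by simp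
qed

text \<open>A clique using some \<open>m\<close> in \<open>I\<close> must give up a non-neighbour of
  \<open>m\<close> in \<open>K\<close>, so nothing is gained over \<open>K\<close>.\<close>

lemma clique_number_undominated:
  assumes "\<forall>m\<in>I. \<exists>i\<in>K. {i, m} \<notin> E"
  shows "clique_number V E = card K"
proof (rule clique_number_eqI[OF finV cl])
  fix Q assume Q: "is_clique V E Q"
  show "card Q \<le> card K"
  proof (cases "Q \<inter> I = {}")
    case True
    then have "Q \<subseteq> K" using Q part(1) unfolding is_clique_def by blast
    then show ?thesis using finKI by (intro card_mono) auto
  next
    case False
    then obtain m where m: "m \<in> Q \<inter> I" by blast
    then obtain i where i: "i \<in> K" "{i, m} \<notin> E" using assms by blast
    have "Q \<subseteq> insert m (K - {i})" using clique_independent_part_le[OF Q m] i by blast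
    then have "card Q \<le> card (insert m (K - {i}))" using finKI by (intro card_mono) auto
    also have "\<dots> \<le> Suc (card (K - {i}))" using finKI by (simp add: card_insert_if)
    also have "\<dots> = card K" by (rule card_Suc_Diff1[OF finKI(1) i(1)])
    finally show ?thesis .
  qed
qed

end

section \<open>Spectra and clique numbers along the threshold construction\<close>

lemma eigensystem_isolated:
  assumes g: "simple_graph V E" and V0: "V \<noteq> {}" and z: "z \<notin> V" and es: "eigensystem V E v l"
  shows "\<exists>v'. eigensystem (insert z V) E v' (\<lambda>i. if i < card V - 1 then l i else 0)"
proof -
  let ?n = "card V" and ?V = "insert z V"
  have fin: "finite V" using g by (simp add: simple_graph_def)
  have n: "0 < ?n" using V0 fin by (simp add: card_gt_0_iff)
  have card': "card ?V = Suc ?n" using z fin by simp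
  \<comment> \<open>The function with value 1 on \<open>V\<close> and \<open>- card V\<close> at
    \<open>z\<close> has squared norm n + n^2, where n is \<open>card V\<close>.\<close>
  define s where "s = 1 / sqrt (real ?n * (real ?n + 1))"
  define f where "f u = s * (if u = z then - real ?n else 1)" for u
  \<comment> \<open>The old constant, extended by 0, is no longer constant. Together with the
    indicator of \<open>z\<close> it spans a plane in the kernel, whose new basis consists of
    \<open>f\<close> and the constant on the larger vertex set.\<close>
  define v' where "v' i = (if i < ?n - 1 then (\<lambda>u. if u = z then 0 else v i u) else
    if i = ?n - 1 then f else (\<lambda>_. 1 / sqrt (real ?n + 1)))" for i
  define l' where "l' i = (if i < ?n - 1 then l i else 0)" for i
  have ss: "s * s * (real ?n * (real ?n + 1)) = 1" using n by (simp add: s_def)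
  have ipz: "ip ?V a b = a z * b z + ip V a b" for a b
    unfolding ip_def using z fin by simp
  have zne: "u \<noteq> z" if "u \<in> V" for u using that z by blast
  have ip_ext: "ip V (\<lambda>u. if u = z then 0 else v i u) b = ip V (v i) b" for i b
    by (rule ip_cong) (use zne in auto)
  have fV: "ip V a f = s * (\<Sum>u\<in>V. a u)" for a
  proof -
    have "ip V a f = (\<Sum>u\<in>V. s * a u)"
      unfolding ip_def by (intro sum.cong refl) (use zne in \<open>simp add: f_def\<close>)
    then show ?thesis by (simp add: sum_distrib_left)
  qed
  have cV: "ip V a (\<lambda>_. c) = c * (\<Sum>u\<in>V. a u)" for a c
    by (simp add: ip_def sum_distrib_left mult.commute)
  have sumf: "(\<Sum>u\<in>V. f u) = s * real ?n"
  proof -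
    have "(\<Sum>u\<in>V. f u) = (\<Sum>u\<in>V. s)" by (intro sum.cong refl) (use zne in \<open>simp add: f_def\<close>)
    then show ?thesis by simp
  qed
  have fz: "f z = - (s * real ?n)" by (simp add: f_def)
  have "?n \<noteq> ?n - 1" "\<not> ?n < ?n - 1" using n by linarith+
  then have v'_simps: "v' (?n - 1) = f" "v' ?n = (\<lambda>_. 1 / sqrt (real ?n + 1))"
    "\<And>i. i < ?n - 1 \<Longrightarrow> v' i = (\<lambda>u. if u = z then 0 else v i u)"
    by (simp_all add: v'_def)
  have main: "ip ?V (v' i) (v' j) = (if i = j then 1 else 0)" if ij: "i \<le> j" "j < Suc ?n" for i j
  proof -
    consider "j < ?n - 1" | "i < ?n - 1" "j = ?n - 1" | "i < ?n - 1" "j = ?n"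
      | "i = ?n - 1" "j = ?n - 1" | "i = ?n - 1" "j = ?n" | "i = ?n" "j = ?n"
      using ij n by linarith
    then show ?thesis
    proof cases
      case 1
      then have "i < ?n - 1" using ij(1) by simp
      with 1 have "ip ?V (v' i) (v' j) = ip V (v i) (v j)"
        using ip_ext[of i] ip_ext[of j] ip_commute[of V "v i"] by (simp only: ipz v'_simps) simp
      also have "\<dots> = (if i = j then 1 else 0)"
        using eigensystemD(1)[OF es] 1 ij(1) by (simp add: orthonormal_on_ip)
      finally show ?thesis .
    next
      case 2
      then have "ip ?V (v' i) (v' j) = 0"
        using eigensystem_perp[OF es 2(1)] by (simp only: ipz v'_simps ip_ext fV) simp
      then show ?thesis using 2 by simp
    next
      case 3
      then have "ip ?V (v' i) (v' j) = 0"
        using eigensystem_perp[OF es 3(1)] by (simp only: ipz v'_simps ip_ext cV) simp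
      then show ?thesis using 3 by simp
    next
      case 4
      have "ip ?V f f = s * s * (real ?n * (real ?n + 1))"
        unfolding ipz fV sumf fz by (simp add: algebra_simps)
      then show ?thesis unfolding 4 v'_simps ss by simp
    next
      case 5
      have "ip ?V f (\<lambda>_. 1 / sqrt (real ?n + 1)) = 0"
        unfolding ipz cV sumf fz by simp
      then show ?thesis using n unfolding 5 v'_simps by simp
    next
      case 6
      have "ip ?V (\<lambda>_. 1 / sqrt (real ?n + 1)) (\<lambda>_. 1 / sqrt (real ?n + 1)) = 1"
        unfolding ip_def sum_constant card' by simp
      then show ?thesis unfolding 6 v'_simps by simp
    qed
  qed
  have o: "orthonormal_on ?V (card ?V) v'"
    unfolding orthonormal_on_ip card'
  proof (intro allI impI)
    fix i j assume ij: "i < Suc ?n" "j < Suc ?n"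
    show "ip ?V (v' i) (v' j) = (if i = j then 1 else 0)"
    proof (cases "i \<le> j")
      case True
      then show ?thesis using main ij by simp
    next
      case False
      then have "ip ?V (v' j) (v' i) = 0" using main[of j i] ij by simp
      then show ?thesis using False ip_commute[of ?V "v' i"] by simp
    qed
  qed
  have noedge: "{u, z} \<notin> E" "{z, u} \<notin> E" for u
    using simple_graph_edgeD(3)[OF g, of u z] simple_graph_edgeD(2)[OF g, of z u] z by blast+
  have lapV: "graph_lap ?V E h u = graph_lap V E h u" for h u
    unfolding graph_lap_def using z fin noedge by simp
  have lapz: "graph_lap V E h z = 0" for h
    unfolding graph_lap_def using noedge by (intro sum.neutral) simp
  have const: "graph_lap V E h u = 0" if "u \<in> V" "\<forall>w\<in>V. h w = c" for h u and c :: real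
    unfolding graph_lap_def using that by (intro sum.neutral) simp
  have eig: "graph_lap ?V E (v' i) u = l' i * v' i u" if i: "i < card ?V" and u: "u \<in> ?V" for i u
  proof (cases "i < ?n - 1")
    case True
    show ?thesis
    proof (cases "u = z")
      case True
      then show ?thesis using \<open>i < ?n - 1\<close> by (simp add: lapV lapz v'_def)
    next
      case False
      then have uV: "u \<in> V" using u by simp
      have "graph_lap V E (v' i) u = graph_lap V E (v i) u"
        unfolding graph_lap_def using True zne uV by (intro sum.cong refl) (auto simp: v'_def)
      then show ?thesis using eigensystemD(2)[OF es _ uV, of i] True False
        by (simp add: lapV v'_def l'_def)
    qed
  next
    case False
    have "graph_lap V E (v' i) u = 0"
    proof (cases "u = z")
      case False
      have "\<forall>w\<in>V. v' i w = (if i = ?n - 1 then s else 1 / sqrt (real ?n + 1))"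
        using \<open>\<not> i < ?n - 1\<close> zne by (auto simp: v'_def f_def)
      then show ?thesis using const[of u "v' i"] u False by blast
    qed (simp add: lapz)
    then show ?thesis using False by (simp add: lapV l'_def)
  qed
  have anti: "l' j \<le> l' i" if "i \<le> j" "j < card ?V" for i j
  proof (cases "j < ?n - 1")
    case True
    then show ?thesis using that eigensystemD(3)[OF es that(1)] by (simp add: l'_def)
  next
    case False
    then have "l' j = 0" by (simp add: l'_def)
    moreover have "0 \<le> l' i" using eigensystem_nonneg[OF es, of i] by (simp add: l'_def)
    ultimately show ?thesis by simp
  qed
  have "eigensystem ?V E v' l'"
    unfolding eigensystem_def using o eig anti n by (auto simp: card' v'_def add.commute)
  then show ?thesis unfolding l'_def by blast
qed

text \<open>Adding a dominating vertex is adding an isolated vertex to the complement.\<close>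

lemma eigensystem_dominating:
  assumes g: "simple_graph V E" and V0: "V \<noteq> {}" and z: "z \<notin> V" and es: "eigensystem V E v l"
  shows "\<exists>v'. eigensystem (insert z V) (E \<union> (\<lambda>u. {u, z}) ` V) v'
    (\<lambda>i. if i = 0 then real (card V) + 1 else if i < card V then 1 + l (i - 1) else 0)"
proof -
  let ?n = "card V" and ?V = "insert z V"
  have fin: "finite V" using g by (simp add: simple_graph_def)
  have n: "0 < ?n" using V0 fin by (simp add: card_gt_0_iff)
  have card': "card ?V = Suc ?n" using z fin by simp
  \<comment> \<open>Complement, isolated vertex, complement again. The inserted zero becomes the top
    eigenvalue n + 1, and an old eigenvalue turns into (n + 1) - (n - l) = 1 + l, one position
    later; here n is \<open>card V\<close>.\<close>
  define l1 where "l1 i = (if i < ?n - 1 then real ?n - l (?n - 2 - i) else 0)" for i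
  define l2 where "l2 i = (if i < ?n - 1 then l1 i else 0)" for i
  define l3 where "l3 i = (if i < card ?V - 1 then real (card ?V) - l2 (card ?V - 2 - i) else 0)" for i
  obtain v1 where v1: "eigensystem V (compl_edges V E) v1 l1"
    using eigensystem_compl[OF g es] unfolding l1_def by blast
  have g1: "simple_graph V (compl_edges V E)" by (rule simple_graph_compl[OF fin])
  obtain v2 where v2: "eigensystem ?V (compl_edges V E) v2 l2"
    using eigensystem_isolated[OF g1 V0 z v1] unfolding l2_def by blast
  have g2: "simple_graph ?V (compl_edges V E)" using g1 unfolding simple_graph_def by auto
  obtain v3 where v3: "eigensystem ?V (compl_edges ?V (compl_edges V E)) v3 l3"
    using eigensystem_compl[OF g2 v2] unfolding l3_def by blast
  have "compl_edges ?V (compl_edges V E) = E \<union> (\<lambda>u. {u, z}) ` V"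
  proof
    show "compl_edges ?V (compl_edges V E) \<subseteq> E \<union> (\<lambda>u. {u, z}) ` V"
    proof
      fix e assume e: "e \<in> compl_edges ?V (compl_edges V E)"
      then have e': "e \<subseteq> ?V" "card e = 2" "e \<notin> compl_edges V E" by (auto simp: compl_edges_def)
      then obtain a b where ab: "e = {a, b}" "a \<noteq> b" unfolding card_2_iff by blast
      show "e \<in> E \<union> (\<lambda>u. {u, z}) ` V"
      proof (cases "z \<in> e")
        case True
        then have "e = {b, z} \<and> b \<noteq> z \<or> e = {a, z} \<and> a \<noteq> z" using ab by auto
        then show ?thesis using e'(1) by blast
      next
        case False
        then show ?thesis using e' by (auto simp: compl_edges_def)
      qed
    qed
    show "E \<union> (\<lambda>u. {u, z}) ` V \<subseteq> compl_edges ?V (compl_edges V E)"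
      using g z by (auto simp: compl_edges_def simple_graph_def card_insert_if)
  qed
  moreover have "l3 = (\<lambda>i. if i = 0 then real ?n + 1 else if i < ?n then 1 + l (i - 1) else 0)"
  proof
    fix i
    have "?n - 2 - (?n - 1 - i) = i - 1" "?n - 1 - i < ?n - 1" if "i < ?n" "i \<noteq> 0" using that by auto
    then show "l3 i = (if i = 0 then real ?n + 1 else if i < ?n then 1 + l (i - 1) else 0)"
      using n by (auto simp: l3_def l2_def l1_def card')
  qed
  ultimately show ?thesis using v3 by auto
qed

lemma clique_number_isolated:
  assumes g: "simple_graph V E" and V0: "V \<noteq> {}" and z: "z \<notin> V"
  shows "clique_number (insert z V) E = clique_number V E"
proof -
  have fin: "finite V" using g by (simp add: simple_graph_def)
  obtain Q where Q: "is_clique V E Q" "card Q = clique_number V E"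
    by (rule clique_number_attained[OF fin])
  have "clique_number (insert z V) E = card Q"
  proof (rule clique_number_eqI)
    show "is_clique (insert z V) E Q" using Q(1) by (auto simp: is_clique_def)
    fix Q' assume Q': "is_clique (insert z V) E Q'"
    show "card Q' \<le> card Q"
    proof (cases "z \<in> Q'")
      case True
      have "{u, z} \<notin> E" for u using simple_graph_edgeD(3)[OF g, of u z] z by blast
      then have "Q' = {z}" using Q' True unfolding is_clique_def by blast
      then show ?thesis using clique_number_bounds(1)[OF fin V0, of E] Q(2) by simp
    next
      case False
      then have "is_clique V E Q'" using Q' by (auto simp: is_clique_def)
      then show ?thesis using clique_number_ge[OF fin] Q(2) by metis
    qed
  qed (use fin in simp)
  then show ?thesis using Q(2) by simp
qed

lemma clique_number_dominating:
  assumes g: "simple_graph V E" and z: "z \<notin> V"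
  shows "clique_number (insert z V) (E \<union> (\<lambda>u. {u, z}) ` V) = clique_number V E + 1"
proof -
  let ?E = "E \<union> (\<lambda>u. {u, z}) ` V"
  have fin: "finite V" using g by (simp add: simple_graph_def)
  obtain Q where Q: "is_clique V E Q" "card Q = clique_number V E"
    by (rule clique_number_attained[OF fin])
  have QV: "Q \<subseteq> V" using Q(1) by (simp add: is_clique_def)
  then have card: "card (insert z Q) = card Q + 1"
    using z finite_subset[OF QV fin] by (subst card_insert_disjoint) auto
  have "clique_number (insert z V) ?E = card (insert z Q)"
  proof (rule clique_number_eqI)
    show "is_clique (insert z V) ?E (insert z Q)"
      using Q(1) QV by (auto simp: is_clique_def insert_commute)
    fix Q' assume Q': "is_clique (insert z V) ?E Q'"
    have fQ': "finite Q'" using Q' fin by (auto simp: is_clique_def intro: finite_subset)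
    have "{u, w} \<in> E" if "u \<in> Q' - {z}" "w \<in> Q' - {z}" "u \<noteq> w" for u w
    proof -
      have "{u, w} \<in> ?E" using Q' that by (auto simp: is_clique_def)
      then show ?thesis using that by (auto simp: doubleton_eq_iff)
    qed
    then have "is_clique V E (Q' - {z})" using Q' by (auto simp: is_clique_def)
    then have "card (Q' - {z}) \<le> card Q" using clique_number_ge[OF fin] Q(2) by metis
    then show "card Q' \<le> card (insert z Q)"
      unfolding card using fQ' by (simp add: card_Diff_singleton_if split: if_splits)
  qed (use fin in simp)
  then show ?thesis using card Q(2) by simp
qed

text \<open>With w the clique number and k = w - 1, an isolated vertex changes nothing, because w is
  at most the old number n of vertices and so only old nontrivial eigenvalues are summed. A
  dominating vertex adds n + 1 + k to the sum, against n new edges and an increase of k + 1 in the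
  binomial coefficient.\<close>

lemma threshold_eigenvalue_sum:
  assumes "threshold_graph V E"
  shows "simple_graph V E \<and> V \<noteq> {} \<and> (\<exists>v l. eigensystem V E v l \<and>
    (\<Sum>i<clique_number V E - 1. l i) = card E + real (clique_number V E choose 2))"
  using assms
proof induction
  case (single z)
  have g: "simple_graph {z} {}" by (simp add: simple_graph_def)
  have "clique_number {z} {} = 1" using clique_number_bounds[of "{z}" "{}"] by simp
  then show ?case using g eigensystem_exists[OF g] by simp
next
  case (isolated V E z)
  then have g: "simple_graph V E" and V0: "V \<noteq> {}" by auto
  obtain v l where es: "eigensystem V E v l"
    and S: "(\<Sum>i<clique_number V E - 1. l i) = card E + real (clique_number V E choose 2)"
    using isolated.IH by blast
  have fin: "finite V" using g by (simp add: simple_graph_def)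
  have "clique_number V E \<le> card V" by (rule clique_number_bounds(2)[OF fin V0])
  then have "(\<Sum>i<clique_number V E - 1. if i < card V - 1 then l i else 0) = (\<Sum>i<clique_number V E - 1. l i)"
    by (intro sum.cong refl) auto
  moreover have "simple_graph (insert z V) E" using g unfolding simple_graph_def by auto
  ultimately show ?case
    using eigensystem_isolated[OF g V0 isolated.hyps(2) es] S
    unfolding clique_number_isolated[OF g V0 isolated.hyps(2)] by auto
next
  case (dominating V E z)
  let ?E = "E \<union> (\<lambda>u. {u, z}) ` V"
  from dominating have g: "simple_graph V E" and V0: "V \<noteq> {}" by auto
  obtain v l where es: "eigensystem V E v l"
    and S: "(\<Sum>i<clique_number V E - 1. l i) = card E + real (clique_number V E choose 2)"
    using dominating.IH by blast
  have fin: "finite V" using g by (simp add: simple_graph_def)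
  have z: "z \<notin> V" by (rule dominating.hyps(2))
  obtain k where k: "clique_number V E = Suc k"
    using clique_number_bounds(1)[OF fin V0, of E] by (cases "clique_number V E") auto
  have kn: "k < card V" using clique_number_bounds(2)[OF fin V0, of E] k by simp
  define l' where "l' i = (if i = 0 then real (card V) + 1 else if i < card V then 1 + l (i - 1) else 0)" for i
  have "(\<Sum>i<Suc k. l' i) = l' 0 + (\<Sum>i<k. l' (Suc i))" by (rule sum.lessThan_Suc_shift)
  also have "(\<Sum>i<k. l' (Suc i)) = (\<Sum>i<k. 1 + l i)"
    using kn by (intro sum.cong refl) (auto simp: l'_def)
  finally have S': "(\<Sum>i<Suc k. l' i) = real (card V) + 1 + k + card E + real (Suc k choose 2)"
    using S by (simp add: k l'_def sum.distrib)
  have "card ?E = card E + card V"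
  proof -
    have "inj_on (\<lambda>u. {u, z}) V" by (auto simp: inj_on_def doubleton_eq_iff)
    then have "card ((\<lambda>u. {u, z}) ` V) = card V" by (rule card_image)
    moreover have "E \<inter> (\<lambda>u. {u, z}) ` V = {}"
      using simple_graph_edgeD(3)[OF g, of _ z] z by blast
    ultimately show ?thesis using card_Un_disjoint[OF finite_edges[OF g]] fin by simp
  qed
  moreover have "simple_graph (insert z V) ?E"
    using g z unfolding simple_graph_def by (auto simp: card_insert_if)
  moreover have "Suc (Suc k) choose 2 = Suc k + (Suc k choose 2)" by (simp add: numeral_2_eq_2)
  moreover obtain v' where "eigensystem (insert z V) ?E v' l'"
    using eigensystem_dominating[OF g V0 z es] unfolding l'_def by blast
  ultimately show ?case
    using S' unfolding clique_number_dominating[OF g z] k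
    by (intro conjI exI[of _ v'] exI[of _ l']) simp_all
qed

theorem theorem3p2:
  fixes V :: "'a set" and E :: "'a set set" and vs :: "'a list" and n m k :: nat
  assumes "simple_graph V E"
    and "split_graph V E"
    and "n = card V" and "n \<ge> 2"
    and "m = card E"
    and "distinct vs" and "set vs = V"
    and "k \<in> {1..n - 1}"
  shows "laplacian_sum vs E k \<le> real m + real ((k + 1) choose 2) \<and>
    (laplacian_sum vs E k = real m + real ((k + 1) choose 2) \<longleftrightarrow>
      threshold_graph V E \<and> clique_number V E = k + 1)"
proof -
  have k: "1 \<le> k" "k < card V" using assms by auto
  then have V0: "V \<noteq> {}" by auto
  obtain K I where "K \<union> I = V" "K \<inter> I = {}" "is_clique V E K" "is_independent V E I"
    using assms(2) unfolding split_graph_def by blast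
  then have sp: "split_partition V K I E" using assms(1) by (simp add: split_partition_def)
  interpret split_partition V K I E by (rule sp)
  obtain v l where es: "eigensystem V E v l" using eigensystem_exists[OF g V0] by blast
  have L: "laplacian_sum vs E k = (\<Sum>i<k. l i)" if "eigensystem V E v l" for v l
    using laplacian_sum_eigensystem[OF g assms(6,7) that] k by simp
  show ?thesis
  proof (intro conjI iffI)
    show "laplacian_sum vs E k \<le> real m + real ((k + 1) choose 2)"
      unfolding L[OF es] assms(5) by (rule split_graph_bound(1)[OF sp es k(2)])
    assume "laplacian_sum vs E k = real m + real ((k + 1) choose 2)"
    then have "(\<Sum>i<k. l i) = card E + real ((k + 1) choose 2)"
      unfolding L[OF es] assms(5) .
    note eq = split_graph_bound(2)[OF sp es k(2) this]
    show "threshold_graph V E"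
      using nested_split_threshold[OF sp _ V0] eq by blast
    from eq show "clique_number V E = k + 1"
    proof (elim conjE disjE)
      assume "card K = k" "\<forall>i\<in>K. \<exists>m\<in>I. {i, m} \<in> E" "alternating_free K I E"
      \<comment> \<open>A common neighbour exists only over a nonempty \<open>K\<close>; this is
        where \<open>k \<ge> 1\<close> enters.\<close>
      moreover from this have "K \<noteq> {}" using k(1) by auto
      ultimately show ?thesis using clique_number_dominated by simp
    next
      assume "card K = k + 1" "\<forall>m\<in>I. \<exists>i\<in>K. {i, m} \<notin> E"
      then show ?thesis using clique_number_undominated by simp
    qed
  next
    assume "threshold_graph V E \<and> clique_number V E = k + 1"
    then obtain v l where es': "eigensystem V E v l"
      and "(\<Sum>i<k. l i) = card E + real ((k + 1) choose 2)"
      using threshold_eigenvalue_sum[of V E] by auto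
    then show "laplacian_sum vs E k = real m + real ((k + 1) choose 2)"
      unfolding L[OF es'] assms(5) by simp
  qed
qed

end
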